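(* Let $\Bbbk$ be a field of characteristic $0$, let $n\ge2$, and let $\Bbbk^{(n)}=\Bbbk(t_1,\dots,t_n)$. Suppose that $b=t_1\cdots t_n\,p(u)$, where $p(t)\in\Bbbk[t]$ is a polynomial of degree $h\ge2$ and $u\in\Bbbk^{(n)}\setminus\Bbbk$, and that $a=t_1\cdots t_n\,p_0(t_1)$, where $p_0(t)\in\Bbbk[t]$ is a polynomial of degree $h_0$ strictly between $0$ and $h$. Then the partial differential equation $$\frac{\partial(y_1,\dots,y_n)}{\partial(t_1,\dots,t_n)}=\frac{b(y_1,\dots,y_n)}{a(t_1,\dots,t_n)}$$ has no solution.
   Context: $\frac{\partial(y_1,\dots,y_n)}{\partial(t_1,\dots,t_n)}=\det\big(\partial y_i/\partial t_j\big)_{1\le i,j\le n}\in\Bbbk^{(n)}$ is the Jacobian determinant of $y_1,\dots,y_n\in\Bbbk^{(n)}$. For nonzero $a,b\in\Bbbk^{(n)}$, the equation is said to have a solution if there are elements $y_1,\dots,y_n\in\Bbbk^{(n)}$, algebraically independent over $\Bbbk$, for which it holds; here $b(y_1,\dots,y_n)$ is the result of substituting $t_i\mapsto y_i$ in $b=b(t_1,\dots,t_n)$. *)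

theory Defs
  imports
    "HOL-Library.Poly_Mapping"
    "HOL-Computational_Algebra.Polynomial"
    "HOL-Computational_Algebra.Fraction_Field"
    "HOL-Analysis.Determinants"
begin

(* Polynomials in variables t_i (i :: 'n) over 'k are finitely supported maps from monomials
   'n \<Rightarrow>\<^sub>0 nat to coefficients, and rational functions are fractions of them.  The index type 'n
   stands for {1, ..., n}; besides numbering the variables, its linear order is what makes the
   polynomials an instance of idom in the library, which fract requires. *)

type_synonym ('n, 'k) polyfun = "('n \<Rightarrow>\<^sub>0 nat) \<Rightarrow>\<^sub>0 'k"

type_synonym ('n, 'k) ratfun = "('n, 'k) polyfun fract"

definition ratfun_const :: "'k \<Rightarrow> ('n::linorder, 'k::field) ratfun" where
  "ratfun_const c = Fract (Poly_Mapping.single 0 c) 1"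

definition ratfun_var :: "'n \<Rightarrow> ('n::linorder, 'k::field) ratfun" where
  "ratfun_var i = Fract (Poly_Mapping.single (Poly_Mapping.single i 1) 1) 1"

lemma ratfun_const_0 [simp]: "ratfun_const 0 = 0"
  by (simp add: ratfun_const_def fract_collapse)

lemma ratfun_const_1 [simp]: "ratfun_const 1 = 1"
  by (simp add: ratfun_const_def fract_collapse)

lemma ratfun_const_add: "ratfun_const (c + d) = ratfun_const c + ratfun_const d"
  by (simp add: ratfun_const_def single_add)

lemma ratfun_const_mult: "ratfun_const (c * d) = ratfun_const c * ratfun_const d"
  by (simp add: ratfun_const_def mult_single)

lemma ratfun_const_eq_0_iff [simp]: "ratfun_const c = 0 \<longleftrightarrow> c = 0"
proof -
  have "Poly_Mapping.single 0 c = 0 \<longleftrightarrow> c = 0"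
    by (metis lookup_single_eq lookup_zero single_zero)
  then show ?thesis
    by (simp add: ratfun_const_def Zero_fract_def eq_fract)
qed


subsection \<open>Partial derivatives\<close>

lemma polyfun_induct [case_names zero single add]:
  fixes P :: "('n, 'k::field) polyfun"
  assumes zero: "R 0" and single: "\<And>m c. R (Poly_Mapping.single m c)"
    and add: "\<And>P Q. R P \<Longrightarrow> R Q \<Longrightarrow> R (P + Q)"
  shows "R P"
proof (induction P rule: Poly_Mapping.update_induct)
  case const
  show ?case by (rule zero)
next
  case (update f a b)
  then have "Poly_Mapping.update a b f = Poly_Mapping.single a b + f"
    by (intro poly_mapping_eqI) (auto simp: lookup_update lookup_add lookup_single in_keys_iff when_def)
  with update show ?case by (simp add: single add)
qed

(* For a monomial m not involving t_i the summand is 0, so the truncated subtraction is harmless. *)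
definition poly_pderiv :: "'n \<Rightarrow> ('n, 'k::field) polyfun \<Rightarrow> ('n, 'k) polyfun" where
  "poly_pderiv i P = (\<Sum>m\<in>Poly_Mapping.keys P.
     Poly_Mapping.single (m - Poly_Mapping.single i 1)
       (of_nat (Poly_Mapping.lookup m i) * Poly_Mapping.lookup P m))"

lemma poly_pderiv_superset:
  assumes "finite A" "Poly_Mapping.keys P \<subseteq> A"
  shows "poly_pderiv i P = (\<Sum>m\<in>A. Poly_Mapping.single (m - Poly_Mapping.single i 1)
           (of_nat (Poly_Mapping.lookup m i) * Poly_Mapping.lookup P m))"
  unfolding poly_pderiv_def using assms
  by (intro sum.mono_neutral_left) (auto simp: in_keys_iff)

lemma poly_pderiv_0 [simp]: "poly_pderiv i 0 = 0"
  by (simp add: poly_pderiv_def)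

lemma poly_pderiv_single:
  "poly_pderiv i (Poly_Mapping.single m c) =
     Poly_Mapping.single (m - Poly_Mapping.single i 1) (of_nat (Poly_Mapping.lookup m i) * c)"
  by (simp add: poly_pderiv_def)

lemma poly_pderiv_add: "poly_pderiv i (P + Q) = poly_pderiv i P + poly_pderiv i Q"
proof -
  let ?A = "Poly_Mapping.keys P \<union> Poly_Mapping.keys Q"
  have "Poly_Mapping.keys (P + Q) \<subseteq> ?A"
    by (rule Poly_Mapping.keys_add)
  then show ?thesis
    by (simp add: poly_pderiv_superset[of ?A] lookup_add algebra_simps single_add sum.distrib)
qed

lemma poly_pderiv_mult_single:
  "poly_pderiv i (Poly_Mapping.single m c * Poly_Mapping.single l d) =
     poly_pderiv i (Poly_Mapping.single m c) * Poly_Mapping.single l d +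
     Poly_Mapping.single m c * poly_pderiv i (Poly_Mapping.single l d)"
proof -
  let ?e = "Poly_Mapping.single i (1::nat)"
  have shift: "(m - ?e) + l = m + l - ?e" if "Poly_Mapping.lookup m i \<noteq> 0" for m l :: "'a \<Rightarrow>\<^sub>0 nat"
    using that by (intro poly_mapping_eqI) (auto simp: lookup_add lookup_minus lookup_single when_def)
  have left: "Poly_Mapping.single ((m - ?e) + l) (of_nat (Poly_Mapping.lookup m i) * c * d) =
      Poly_Mapping.single (m + l - ?e) (of_nat (Poly_Mapping.lookup m i) * c * d)"
    by (cases "Poly_Mapping.lookup m i = 0") (simp_all add: shift del: One_nat_def)
  have right: "Poly_Mapping.single (m + (l - ?e)) (c * (of_nat (Poly_Mapping.lookup l i) * d)) =
      Poly_Mapping.single (m + l - ?e) (c * (of_nat (Poly_Mapping.lookup l i) * d))"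
    using shift[of l m] by (cases "Poly_Mapping.lookup l i = 0") (simp_all add: add.commute del: One_nat_def)
  show ?thesis
    unfolding poly_pderiv_single mult_single left right single_add[symmetric] lookup_add
    by (simp add: algebra_simps)
qed

lemma poly_pderiv_mult: "poly_pderiv i (P * Q) = poly_pderiv i P * Q + P * poly_pderiv i Q"
proof (induction P rule: polyfun_induct)
  case (single m c)
  show ?case
  proof (induction Q rule: polyfun_induct)
    case (single l d)
    show ?case by (rule poly_pderiv_mult_single)
  qed (simp_all add: poly_pderiv_add distrib_left distrib_right)
qed (simp_all add: poly_pderiv_add distrib_left distrib_right)

lemma quotient_rule_cong:
  assumes eq: "P * Q' = P' * Q"
  shows "(poly_pderiv i P * Q - P * poly_pderiv i Q) * (Q' * Q') =
    (poly_pderiv i P' * Q' - P' * poly_pderiv i Q') * (Q * Q)"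
proof -
  have d: "poly_pderiv i P * Q' + P * poly_pderiv i Q' = poly_pderiv i P' * Q + P' * poly_pderiv i Q"
    using arg_cong[OF eq, of "poly_pderiv i"] by (simp add: poly_pderiv_mult)
  have "(poly_pderiv i P * Q - P * poly_pderiv i Q) * (Q' * Q') =
      (poly_pderiv i P * Q') * Q * Q' - (P * Q') * poly_pderiv i Q * Q'"
    by (simp add: algebra_simps)
  also have "poly_pderiv i P * Q' = poly_pderiv i P' * Q + P' * poly_pderiv i Q - P * poly_pderiv i Q'"
    using d by (simp add: eq_diff_eq)
  also have "(poly_pderiv i P' * Q + P' * poly_pderiv i Q - P * poly_pderiv i Q') * Q * Q' -
      (P * Q') * poly_pderiv i Q * Q' =
      poly_pderiv i P' * Q * Q * Q' + (P' * Q) * poly_pderiv i Q * Q' -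
      (P * Q') * poly_pderiv i Q' * Q - (P * Q') * poly_pderiv i Q * Q'"
    by (simp add: algebra_simps)
  also have "\<dots> = (poly_pderiv i P' * Q' - P' * poly_pderiv i Q') * (Q * Q)"
    unfolding eq by (simp add: algebra_simps)
  finally show ?thesis .
qed

(* The quotient rule; independent of the representation by quotient_rule_cong. *)
definition ratfun_pderiv :: "'n \<Rightarrow> ('n::linorder, 'k::field) ratfun \<Rightarrow> ('n, 'k) ratfun" where
  "ratfun_pderiv i f = (THE z. \<exists>P Q. Q \<noteq> 0 \<and> f = Fract P Q \<and>
     z = Fract (poly_pderiv i P * Q - P * poly_pderiv i Q) (Q * Q))"

lemma ratfun_pderiv_Fract:
  assumes "Q \<noteq> 0"
  shows "ratfun_pderiv i (Fract P Q) =
     Fract (poly_pderiv i P * Q - P * poly_pderiv i Q) (Q * Q)"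
  unfolding ratfun_pderiv_def
proof (rule the_equality)
  fix z
  assume "\<exists>P' Q'. Q' \<noteq> 0 \<and> Fract P Q = Fract P' Q' \<and>
    z = Fract (poly_pderiv i P' * Q' - P' * poly_pderiv i Q') (Q' * Q')"
  then obtain P' Q' where nz: "Q' \<noteq> 0" and eq: "Fract P Q = Fract P' Q'"
    and z: "z = Fract (poly_pderiv i P' * Q' - P' * poly_pderiv i Q') (Q' * Q')"
    by blast
  have "P * Q' = P' * Q"
    using eq assms nz by (simp add: eq_fract)
  then have "(poly_pderiv i P * Q - P * poly_pderiv i Q) * (Q' * Q') =
      (poly_pderiv i P' * Q' - P' * poly_pderiv i Q') * (Q * Q)"
    by (rule quotient_rule_cong)
  moreover have "Q * Q \<noteq> 0" "Q' * Q' \<noteq> 0"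
    using assms nz by simp_all
  ultimately show "z = Fract (poly_pderiv i P * Q - P * poly_pderiv i Q) (Q * Q)"
    unfolding z by (metis eq_fract(1))
qed (use assms in blast)

lemma ratfun_pderiv_var:
  "ratfun_pderiv j (ratfun_var i :: ('n::linorder, 'k::field) ratfun) = (if i = j then 1 else 0)"
proof -
  have "poly_pderiv j 1 = (0 :: ('n, 'k) polyfun)"
    using poly_pderiv_single[of j 0 "1::'k"] by simp
  then show ?thesis
    by (simp add: ratfun_var_def ratfun_pderiv_Fract poly_pderiv_single lookup_single when_def
        fract_collapse)
qed

definition jacobian_det ::
  "('n \<Rightarrow> ('n::{finite,linorder}, 'k::field) ratfun) \<Rightarrow> ('n, 'k) ratfun" where
  "jacobian_det y = det (\<chi> i j. ratfun_pderiv j (y i))"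


subsection \<open>Substitution and algebraic independence\<close>

definition poly_subst ::
  "('n \<Rightarrow> ('n::{finite,linorder}, 'k::field) ratfun) \<Rightarrow> ('n, 'k) polyfun \<Rightarrow> ('n, 'k) ratfun" where
  "poly_subst y P = (\<Sum>m\<in>Poly_Mapping.keys P.
     ratfun_const (Poly_Mapping.lookup P m) * (\<Prod>i\<in>UNIV. y i ^ Poly_Mapping.lookup m i))"

definition alg_indep :: "('n \<Rightarrow> ('n::{finite,linorder}, 'k::field) ratfun) \<Rightarrow> bool" where
  "alg_indep y \<longleftrightarrow> (\<forall>P. poly_subst y P = 0 \<longrightarrow> P = 0)"

(* The value at y of any representation f = P/Q with Q(y) nonzero; it does not depend on the
   representation, and for algebraically independent y every representation with Q nonzero
   qualifies (ratfun_subst_Fract). *)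
definition ratfun_subst ::
  "('n \<Rightarrow> ('n::{finite,linorder}, 'k::field) ratfun) \<Rightarrow> ('n, 'k) ratfun \<Rightarrow> ('n, 'k) ratfun" where
  "ratfun_subst y f = (THE z. \<exists>P Q. f = Fract P Q \<and> poly_subst y Q \<noteq> 0 \<and>
     z = poly_subst y P / poly_subst y Q)"

lemma poly_subst_superset:
  assumes "finite A" "Poly_Mapping.keys P \<subseteq> A"
  shows "poly_subst y P = (\<Sum>m\<in>A.
     ratfun_const (Poly_Mapping.lookup P m) * (\<Prod>i\<in>UNIV. y i ^ Poly_Mapping.lookup m i))"
  unfolding poly_subst_def using assms
  by (intro sum.mono_neutral_left) (auto simp: in_keys_iff)

lemma poly_subst_0 [simp]: "poly_subst y 0 = 0"
  by (simp add: poly_subst_def)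

lemma poly_subst_single:
  "poly_subst y (Poly_Mapping.single m c) =
     ratfun_const c * (\<Prod>i\<in>UNIV. y i ^ Poly_Mapping.lookup m i)"
  by (simp add: poly_subst_def)

lemma poly_subst_add: "poly_subst y (P + Q) = poly_subst y P + poly_subst y Q"
proof -
  let ?A = "Poly_Mapping.keys P \<union> Poly_Mapping.keys Q"
  have "Poly_Mapping.keys (P + Q) \<subseteq> ?A"
    by (rule Poly_Mapping.keys_add)
  then show ?thesis
    by (simp add: poly_subst_superset[of ?A] lookup_add algebra_simps ratfun_const_add sum.distrib)
qed

lemma poly_subst_mult: "poly_subst y (P * Q) = poly_subst y P * poly_subst y Q"
proof (induction P rule: polyfun_induct)
  case (single m c)
  show ?case
  proof (induction Q rule: polyfun_induct)
    case (single l d)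
    show ?case
      by (simp add: mult_single poly_subst_single ratfun_const_mult lookup_add power_add
          prod.distrib algebra_simps)
  qed (simp_all add: poly_subst_add distrib_left distrib_right)
qed (simp_all add: poly_subst_add distrib_left distrib_right)

lemma ratfun_subst_Fract:
  assumes "poly_subst y Q \<noteq> 0"
  shows "ratfun_subst y (Fract P Q) = poly_subst y P / poly_subst y Q"
  unfolding ratfun_subst_def
proof (rule the_equality)
  show "\<exists>P' Q'. Fract P Q = Fract P' Q' \<and> poly_subst y Q' \<noteq> 0 \<and>
      poly_subst y P / poly_subst y Q = poly_subst y P' / poly_subst y Q'"
    using assms by blast
next
  fix z
  assume "\<exists>P' Q'. Fract P Q = Fract P' Q' \<and> poly_subst y Q' \<noteq> 0 \<and>
    z = poly_subst y P' / poly_subst y Q'"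
  then obtain P' Q' where eq: "Fract P Q = Fract P' Q'" and nz: "poly_subst y Q' \<noteq> 0"
    and z: "z = poly_subst y P' / poly_subst y Q'"
    by blast
  have "Q \<noteq> 0" "Q' \<noteq> 0"
    using assms nz by auto
  with eq have "P * Q' = P' * Q"
    by (simp add: eq_fract)
  then have "poly_subst y P * poly_subst y Q' = poly_subst y P' * poly_subst y Q"
    by (metis poly_subst_mult)
  then show "z = poly_subst y P / poly_subst y Q"
    using assms nz z by (simp add: frac_eq_eq)
qed


subsection \<open>The equation\<close>

definition jacobian_eq_has_solution ::
  "('n::{finite,linorder}, 'k::field) ratfun \<Rightarrow> ('n, 'k) ratfun \<Rightarrow> bool" where
  "jacobian_eq_has_solution a b \<longleftrightarrow>
     (\<exists>y. alg_indep y \<and> jacobian_det y = ratfun_subst y b / a)"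

end

theory Submission
  imports Defs "HOL-Computational_Algebra.Polynomial_Factorial"
begin

text \<open>Write \<open>D\<^sub>l\<close> for the Euler operator of \<open>t\<^sub>l\<close> and \<open>v = u(y)\<close>. The equation says that the logarithmic
  Jacobian \<open>f = det (D\<^sub>l y\<^sub>i / y\<^sub>i)\<close> satisfies \<open>f \<cdot> p\<^sub>0(t\<^sub>1) = p(v)\<close>. As \<open>v\<close> is not constant, some \<open>D\<^sub>j v\<close> is
  nonzero, so \<open>v\<close> has a pole at a place of the rational function field in \<open>t\<^sub>j\<close> over the field
  generated by the other variables, and \<open>p(v)\<close> has a pole of order at least \<open>h\<close> there. At a finite
  place \<open>p\<^sub>0(t\<^sub>1)\<close> is regular and \<open>f\<close>, being a logarithmic determinant, has at most a simple pole,
  against \<open>h \<ge> 2\<close>. At the infinite place \<open>f\<close> is regular, because each \<open>D\<^sub>l\<close> maps the uniformizer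
  \<open>1/t\<^sub>j\<close> to a multiple of itself, and \<open>p\<^sub>0(t\<^sub>1)\<close> has a pole of order at most \<open>h\<^sub>0 < h\<close>.

  To work with univariate polynomials over a field, all of this is transported along the embedding
  of \<open>k(t)\<close> into \<open>k(t)(s)\<close> that sends \<open>t\<^sub>j\<close> to \<open>s\<close> and fixes the other variables.\<close>

subsection \<open>Derivations and homomorphisms on fields of fractions\<close>

locale derivation =
  fixes d :: "'a::comm_ring_1 \<Rightarrow> 'a"
  assumes add: "d (x + y) = d x + d y"
    and mult: "d (x * y) = d x * y + x * d y"
begin

lemma zero [simp]: "d 0 = 0"
  using add[of 0 0] by simp

lemma one [simp]: "d 1 = 0"
  using mult[of 1 1] by simp

end

lemma derivation_divide:
  fixes x y :: "'a::field"
  assumes "derivation \<delta>" "y \<noteq> 0"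
  shows "\<delta> (x / y) = (\<delta> x * y - x * \<delta> y) / (y * y)"
proof -
  interpret \<delta>: derivation \<delta> by fact
  have "\<delta> x = \<delta> (x / y) * y + x / y * \<delta> y"
    using \<delta>.mult[of "x / y" y] assms(2) by simp
  then show ?thesis
    using assms(2) by (simp add: field_simps)
qed

text \<open>The quotient rule for an arbitrary derivation of an integral domain, so that one
  construction serves Euler operators on \<open>ratfun\<close> and their counterparts on
  \<open>ratfun poly fract\<close>. The description is well defined by
  \<open>fract_deriv_Fract\<close>.\<close>

definition fract_deriv :: "('a::idom \<Rightarrow> 'a) \<Rightarrow> 'a fract \<Rightarrow> 'a fract" where
  "fract_deriv d x = (THE z. \<exists>P Q. Q \<noteq> 0 \<and> x = Fract P Q \<and> z = Fract (d P * Q - P * d Q) (Q * Q))"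

text \<open>After cross-multiplication, the difference of two quotient-rule values is a combination
  of \<open>P * Q' - P' * Q\<close> and of its derivative, and both vanish when the fractions
  agree.\<close>

lemma fract_deriv_Fract:
  assumes "derivation d" "Q \<noteq> 0"
  shows "fract_deriv d (Fract P Q) = Fract (d P * Q - P * d Q) (Q * Q)"
proof -
  interpret derivation d by fact
  show ?thesis
    unfolding fract_deriv_def
  proof (rule the_equality)
    fix z
    assume "\<exists>P' Q'. Q' \<noteq> 0 \<and> Fract P Q = Fract P' Q' \<and> z = Fract (d P' * Q' - P' * d Q') (Q' * Q')"
    then obtain P' Q' where nz: "Q' \<noteq> 0" and "Fract P Q = Fract P' Q'"
      and z: "z = Fract (d P' * Q' - P' * d Q') (Q' * Q')"
      by blast
    then have eq: "P * Q' = P' * Q"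
      using assms(2) by (simp add: eq_fract)
    then have d: "d P * Q' + P * d Q' = d P' * Q + P' * d Q"
      by (metis mult)
    have "(d P * Q - P * d Q) * (Q' * Q') - (d P' * Q' - P' * d Q') * (Q * Q) =
       (d P * Q' + P * d Q' - (d P' * Q + P' * d Q)) * Q * Q' -
       (P * Q' - P' * Q) * (d Q' * Q + d Q * Q')"
      by (simp add: algebra_simps)
    also have "\<dots> = 0"
      by (simp add: eq d)
    finally show "z = Fract (d P * Q - P * d Q) (Q * Q)"
      using z nz assms(2) by (simp add: eq_fract)
  qed (use assms in blast)
qed

lemma derivation_fract_deriv:
  assumes "derivation d"
  shows "derivation (fract_deriv d)"
proof -
  interpret derivation d by fact
  show ?thesis
  proof
    fix x y :: "'a fract"
    obtain P Q where x: "x = Fract P Q" "Q \<noteq> 0" by (cases x) auto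
    obtain R S where y: "y = Fract R S" "S \<noteq> 0" by (cases y) auto
    show "fract_deriv d (x + y) = fract_deriv d x + fract_deriv d y"
      using x y by (simp add: fract_deriv_Fract[OF assms] eq_fract mult add algebra_simps)
    show "fract_deriv d (x * y) = fract_deriv d x * y + x * fract_deriv d y"
      using x y by (simp add: fract_deriv_Fract[OF assms] eq_fract mult add algebra_simps)
  qed
qed

lemma derivation_mult_left:
  assumes "derivation d"
  shows "derivation (\<lambda>x. c * d x)"
proof -
  interpret derivation d by fact
  show ?thesis by standard (simp_all add: add mult algebra_simps)
qed

lemma coeff_map_poly_derivation:
  assumes "derivation d"
  shows "coeff (map_poly d p) n = d (coeff p n)"
proof -
  interpret derivation d by fact
  show ?thesis by (simp add: coeff_map_poly)
qed

lemma derivation_sum: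
  assumes "derivation d"
  shows "d (sum f S) = (\<Sum>x\<in>S. d (f x))"
proof -
  interpret derivation d by fact
  show ?thesis by (induction S rule: infinite_finite_induct) (simp_all add: add)
qed

lemma derivation_map_poly:
  assumes "derivation d"
  shows "derivation (map_poly d)"
proof -
  interpret derivation d by fact
  show ?thesis
    by standard (simp_all add: poly_eq_iff coeff_map_poly coeff_mult add mult sum.distrib
        derivation_sum[OF assms])
qed

lemma derivation_pderiv: "derivation (pderiv :: 'a::idom poly \<Rightarrow> _)"
  by standard (simp_all add: pderiv_add pderiv_mult algebra_simps)

section \<open>Homomorphisms and their extension to fields of fractions\<close>

locale idom_hom =
  fixes g :: "'a::idom \<Rightarrow> 'b::idom"
  assumes add: "g (x + y) = g x + g y"
    and mult: "g (x * y) = g x * g y"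
    and one: "g 1 = 1"
begin

lemma zero: "g 0 = 0"
  using add[of 0 0] by (metis add_0 add_right_cancel)

lemma minus: "g (- x) = - g x"
  using add[of x "- x"] by (simp add: zero eq_neg_iff_add_eq_0 add.commute)

lemma diff: "g (x - y) = g x - g y"
  using add[of x "- y"] by (simp add: minus)

lemma sum: "g (sum f S) = (\<Sum>x\<in>S. g (f x))"
  by (induction S rule: infinite_finite_induct) (simp_all add: add zero)

lemma prod: "g (prod f S) = (\<Prod>x\<in>S. g (f x))"
  by (induction S rule: infinite_finite_induct) (simp_all add: mult one)

lemma of_nat: "g (of_nat m) = of_nat m"
  by (induction m) (simp_all add: add zero one)

lemma of_int: "g (of_int m) = of_int m"
  by (cases m) (simp_all add: of_nat minus diff one)

lemma det: "g (det (\<chi> i j. M i j)) = det (\<chi> i j. g (M i j))"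
  by (simp add: det_def sum prod mult of_int)

lemma poly_map: "g (poly p x) = poly (map_poly g p) (g x)"
  by (induction p) (simp_all add: zero add mult map_poly_pCons)

end

locale field_hom = idom_hom g for g :: "'a::field \<Rightarrow> 'b::field"
begin

lemma eq_0_iff: "g x = 0 \<longleftrightarrow> x = 0"
proof
  assume "g x = 0"
  then have "g (x * inverse x) = 0" by (simp add: mult)
  then show "x = 0" using one by (cases "x = 0") auto
qed (simp add: zero)

lemma divide: "g (x / y) = g x / g y"
proof (cases "y = 0")
  case False
  have "g (x / y) * g y = g x"
    unfolding mult[symmetric] using False by simp
  then show ?thesis using False by (simp add: eq_0_iff field_simps)
qed (simp add: zero)

end

text \<open>The extension of \<open>g\<close> to fractions; for an injective homomorphism the value
  does not depend on the representation (\<open>lift_Fract\<close>).\<close>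

definition fract_lift :: "('a::idom \<Rightarrow> 'b::field) \<Rightarrow> 'a fract \<Rightarrow> 'b" where
  "fract_lift g x = (THE z. \<exists>P Q. Q \<noteq> 0 \<and> x = Fract P Q \<and> z = g P / g Q)"

locale inj_hom = idom_hom g for g :: "'a::idom \<Rightarrow> 'b::field" +
  assumes eq_0D: "g x = 0 \<Longrightarrow> x = 0"
begin

lemma lift_Fract:
  assumes "Q \<noteq> 0"
  shows "fract_lift g (Fract P Q) = g P / g Q"
  unfolding fract_lift_def
proof (rule the_equality)
  fix z
  assume "\<exists>P' Q'. Q' \<noteq> 0 \<and> Fract P Q = Fract P' Q' \<and> z = g P' / g Q'"
  then obtain P' Q' where nz: "Q' \<noteq> 0" and "Fract P Q = Fract P' Q'" and z: "z = g P' / g Q'"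
    by blast
  then have "P * Q' = P' * Q"
    using assms by (simp add: eq_fract)
  then have "g P * g Q' = g P' * g Q"
    by (metis mult)
  then show "z = g P / g Q"
    using z nz assms eq_0D[of Q] eq_0D[of Q'] by (metis frac_eq_eq)
qed (use assms in blast)

lemma field_hom_lift: "field_hom (fract_lift g)"
proof
  fix x y :: "'a fract"
  obtain P Q where x: "x = Fract P Q" "Q \<noteq> 0" by (cases x) auto
  obtain R S where y: "y = Fract R S" "S \<noteq> 0" by (cases y) auto
  have nz: "g Q \<noteq> 0" "g S \<noteq> 0" using x y eq_0D by auto
  show "fract_lift g (x + y) = fract_lift g x + fract_lift g y"
    using x y nz by (simp add: lift_Fract mult add field_simps)
  show "fract_lift g (x * y) = fract_lift g x * fract_lift g y"
    using x y nz by (simp add: lift_Fract mult)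
next
  show "fract_lift g 1 = 1"
    by (simp add: One_fract_def lift_Fract one)
qed

text \<open>Both sides obey the quotient rule, so commutation on numerators and denominators carries
  over to fractions.\<close>

lemma lift_deriv:
  assumes "derivation d" "derivation \<delta>" "\<And>P. \<delta> (g P) = g (d P)"
  shows "\<delta> (fract_lift g x) = fract_lift g (fract_deriv d x)"
proof -
  obtain P Q where x: "x = Fract P Q" "Q \<noteq> 0" by (cases x) auto
  then have "g Q \<noteq> 0" using eq_0D by auto
  then show ?thesis
    using x by (simp add: fract_deriv_Fract[OF assms(1)] lift_Fract mult diff
        derivation_divide[OF assms(2)] assms(3))
qed

end

subsection \<open>Discrete valuation rings and logarithmic Jacobians\<close>

locale subring_set =
  fixes \<O> :: "'a::comm_ring_1 set"
  assumes one [simp]: "1 \<in> \<O>" and uminus: "x \<in> \<O> \<Longrightarrow> - x \<in> \<O>"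
    and add: "\<lbrakk>x \<in> \<O>; y \<in> \<O>\<rbrakk> \<Longrightarrow> x + y \<in> \<O>" and mult: "\<lbrakk>x \<in> \<O>; y \<in> \<O>\<rbrakk> \<Longrightarrow> x * y \<in> \<O>"
begin

lemma zero [simp]: "0 \<in> \<O>"
  using add[OF one uminus[OF one]] by simp

lemma diff: "\<lbrakk>x \<in> \<O>; y \<in> \<O>\<rbrakk> \<Longrightarrow> x - y \<in> \<O>"
  using add[of x "- y"] uminus[of y] by simp

lemma sum: "(\<And>x. x \<in> S \<Longrightarrow> f x \<in> \<O>) \<Longrightarrow> sum f S \<in> \<O>"
  by (induction S rule: infinite_finite_induct) (auto simp: add)

lemma prod: "(\<And>x. x \<in> S \<Longrightarrow> f x \<in> \<O>) \<Longrightarrow> prod f S \<in> \<O>"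
  by (induction S rule: infinite_finite_induct) (auto simp: mult)

lemma power: "x \<in> \<O> \<Longrightarrow> x ^ m \<in> \<O>"
  by (induction m) (auto simp: mult)

lemma of_nat: "of_nat m \<in> \<O>"
  by (induction m) (auto simp: add)

lemma of_int: "of_int m \<in> \<O>"
  by (cases m) (auto simp: of_nat intro!: diff uminus add)

lemma poly: "\<lbrakk>\<And>i. coeff p i \<in> \<O>; x \<in> \<O>\<rbrakk> \<Longrightarrow> poly p x \<in> \<O>"
  unfolding poly_altdef by (intro sum mult power) auto

lemma det_mem:
  assumes "\<And>i j. M i j \<in> \<O>"
  shows "det (\<chi> i j. M i j) \<in> \<O>"
  unfolding det_def using assms by (auto intro!: sum mult prod of_int)

text \<open>The factor \<open>c\<close> is absorbed by row \<open>k\<close>, after which every entry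
  lies in the ring.\<close>

lemma mult_det_row_mem:
  assumes "\<And>i j. R i j \<in> \<O>" "\<And>j. c * w j \<in> \<O>"
  shows "c * det (\<chi> i. if i = k then (\<chi> j. w j) else (\<chi> j. R i j)) \<in> \<O>"
proof -
  have "c * det (\<chi> i. if i = k then (\<chi> j. w j) else (\<chi> j. R i j)) =
      det (\<chi> i. if i = k then c *s (\<chi> j. w j) else (\<chi> j. R i j))"
    by (simp add: det_row_mul)
  also have "\<dots> = det (\<chi> i j. if i = k then c * w j else R i j)"
    by (rule arg_cong[of _ _ det]) (simp add: vec_eq_iff)
  also have "\<dots> \<in> \<O>"
    using assms by (intro det_mem) auto
  finally show ?thesis .
qed

text \<open>A rank-one perturbation by a vector \<open>w\<close> with a pole contributes only one factor \<open>w\<close> to each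
  term of the determinant, because a matrix with two rows proportional to \<open>w\<close> is singular.\<close>

lemma mult_det_rank_one_mem:
  fixes w :: "'n::finite \<Rightarrow> 'a"
  assumes R: "\<And>i j. R i j \<in> \<O>" and x: "\<And>i. x i \<in> \<O>" and c: "c \<in> \<O>" and w: "\<And>j. c * w j \<in> \<O>"
  shows "c * det (\<chi> i j. x i * w j + R i j) \<in> \<O>"
proof -
  let ?w = "\<chi> j. w j" and ?R = "\<lambda>i. \<chi> j. R i j"
  let ?row = "\<lambda>S i. if i \<in> S then x i *s ?w + ?R i else ?R i"
  \<comment> \<open>\<open>S\<close> is the set of rows already perturbed; row \<open>k\<close> is
    replaced by \<open>w\<close> itself, the only row that needs the factor
    \<open>c\<close>.\<close>
  have one_row: "c * det (\<chi> i. if i = k then ?w else ?row S i) \<in> \<O>" if "k \<notin> S" for S k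
    using finite[of S] that
  proof (induction S rule: finite_induct)
    case empty
    show ?case
      using mult_det_row_mem[where R = R and w = w and c = c and k = k] R w
      by (simp cong: if_cong)
  next
    case (insert a S)
    define B where "B = (\<lambda>i. if i = k then ?w else ?row S i)"
    have ne: "a \<noteq> k" using insert by auto
    have "(\<chi> i. if i = k then ?w else ?row (insert a S) i) =
        (\<chi> i. if i = a then x a *s ?w + ?R a else B i)"
      using ne by (simp add: vec_eq_iff B_def)
    \<comment> \<open>Rows \<open>a\<close> and \<open>k\<close> are both \<open>w\<close>, so
      perturbing row \<open>a\<close> leaves the determinant unchanged.\<close>
    moreover have "det (\<chi> i. if i = a then ?w else B i) = 0"
      by (rule det_identical_rows[OF ne]) (use ne in \<open>simp add: row_def B_def vec_eq_iff\<close>)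
    moreover have "(\<chi> i. if i = a then ?R a else B i) = (\<chi> i. if i = k then ?w else ?row S i)"
      using ne insert by (simp add: vec_eq_iff B_def)
    ultimately show ?case
      using insert by (simp add: det_row_add det_row_mul)
  qed
  have "c * det (\<chi> i. ?row S i) \<in> \<O>" for S
    using finite[of S]
  proof (induction S rule: finite_induct)
    case empty
    show ?case using mult[OF c det_mem[of R]] R by simp
  next
    case (insert a S)
    define B where "B = (\<lambda>i. ?row S i)"
    have "(\<chi> i. ?row (insert a S) i) = (\<chi> i. if i = a then x a *s ?w + ?R a else B i)"
      by (rule arg_cong[of _ _ vec_lambda]) (auto simp: B_def fun_eq_iff)
    moreover have "(\<chi> i. if i = a then ?R a else B i) = (\<chi> i. B i)"
      by (rule arg_cong[of _ _ vec_lambda]) (use insert in \<open>auto simp: B_def fun_eq_iff\<close>)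
    \<comment> \<open>Linearity in row \<open>a\<close>: its \<open>w\<close> part is handled by
      \<open>one_row\<close>, and its \<open>R\<close> part by the induction hypothesis.\<close>
    ultimately have "c * det (\<chi> i. ?row (insert a S) i) =
        x a * (c * det (\<chi> i. if i = a then ?w else B i)) + c * det (\<chi> i. B i)"
      by (simp only: det_row_add det_row_mul) (simp add: algebra_simps)
    moreover have "c * det (\<chi> i. if i = a then ?w else B i) \<in> \<O>"
      unfolding B_def using one_row insert by blast
    moreover have "c * det (\<chi> i. B i) \<in> \<O>"
      unfolding B_def using insert by blast
    ultimately show ?case
      using x by (metis add mult)
  qed
  from this[of UNIV] show ?thesis
    by (simp add: plus_vec_def vector_scalar_mult_def)
qed

end

text \<open>The valuation of \<open>x\<close> is \<open>n - m\<close> in \<open>decomp\<close>; two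
  natural exponents replace an integer one. No valuation function is introduced: a pole of order at
  most \<open>e\<close> is expressed by \<open>\<pi> ^ e * x \<in> \<O>\<close>.\<close>

locale dvr = subring_set \<O> for \<O> :: "'a::field set" +
  fixes \<pi> :: 'a
  assumes uniformizer: "\<pi> \<in> \<O>" "\<pi> \<noteq> 0" "inverse \<pi> \<notin> \<O>"
    and decomp: "x \<noteq> 0 \<Longrightarrow> \<exists>m n z. z \<noteq> 0 \<and> z \<in> \<O> \<and> inverse z \<in> \<O> \<and> x * \<pi> ^ m = \<pi> ^ n * z"
begin

text \<open>If \<open>n\<close> exceeded \<open>m\<close>, cancelling \<open>\<pi> ^ m\<close> would
  place \<open>inverse \<pi>\<close> in the ring.\<close>

lemma uniformizer_power:
  assumes "\<pi> ^ m = \<pi> ^ n * x" "x \<in> \<O>" shows "n \<le> m"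
proof (rule ccontr)
  assume "\<not> n \<le> m"
  then obtain k where "n = m + Suc k" by (metis add_Suc_right less_imp_Suc_add not_le)
  then have "\<pi> ^ m * 1 = \<pi> ^ m * (\<pi> * (\<pi> ^ k * x))"
    using assms(1) by (simp add: power_add algebra_simps)
  then have "inverse \<pi> = \<pi> ^ k * x"
    using uniformizer by (simp add: field_simps)
  then show False
    using uniformizer assms(2) by (simp add: mult power)
qed

text \<open>In \<open>decomp\<close>, \<open>n \<le> m\<close> writes \<open>inverse x\<close> as a
  power of \<pi> times a unit, while \<open>n > m\<close> makes \<open>x\<close> a multiple of
  \<pi>.\<close>

lemma inverse_mem:
  assumes "x \<in> \<O>" "\<not> (\<exists>y\<in>\<O>. x = \<pi> * y)"
  shows "inverse x \<in> \<O>"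
proof -
  have "x \<noteq> 0" using assms(2) by (metis mult_zero_right zero)
  then obtain m n z where z: "z \<noteq> 0" "z \<in> \<O>" "inverse z \<in> \<O>" "x * \<pi> ^ m = \<pi> ^ n * z"
    using decomp by blast
  show ?thesis
  proof (cases "n \<le> m")
    case True
    then have "\<pi> ^ m = \<pi> ^ n * \<pi> ^ (m - n)" by (simp flip: power_add)
    then have "inverse x = \<pi> ^ (m - n) * inverse z"
      using z \<open>x \<noteq> 0\<close> uniformizer by (simp add: field_simps)
    then show ?thesis using z uniformizer by (simp add: mult power)
  next
    case False
    then obtain k where "n = m + Suc k" by (metis add_Suc_right less_imp_Suc_add not_le)
    then have "x = \<pi> * (\<pi> ^ k * z)"
      using z uniformizer by (simp add: field_simps power_add)
    moreover have "\<pi> ^ k * z \<in> \<O>"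
      using z uniformizer by (intro mult power)
    ultimately show ?thesis using assms(2) by blast
  qed
qed

text \<open>Pulling out \<open>v ^ degree p\<close> leaves the reflected polynomial at
  \<open>inverse v\<close>, here \<open>U\<close>. It is congruent to the leading coefficient modulo
  \<pi>, hence a unit, so \<open>poly p v\<close> has a pole of order at least
  \<open>degree p\<close>.\<close>

lemma inverse_poly_at_pole:
  assumes coeffs: "\<And>i. coeff p i \<in> \<O>" and lead: "inverse (lead_coeff p) \<in> \<O>" and "p \<noteq> 0"
    and pole: "inverse v = \<pi> * g" "g \<in> \<O>" "v \<noteq> 0"
  shows "poly p v \<noteq> 0" "\<exists>y\<in>\<O>. inverse (poly p v) = \<pi> ^ degree p * y"
proof -
  define U where "U = poly (reflect_poly p) (inverse v)"
  obtain c r where r: "reflect_poly p = pCons c r" by (cases "reflect_poly p") auto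
  have c: "c = lead_coeff p"
    using r coeff_0_reflect_poly[of p] by simp
  have rc: "coeff (reflect_poly p) i \<in> \<O>" for i
    using coeffs by (simp add: coeff_reflect_poly)
  have "coeff r i \<in> \<O>" for i
    using rc[of "Suc i"] r by simp
  then have rO: "poly r (inverse v) \<in> \<O>"
    using pole uniformizer by (auto intro!: poly mult)
  have U: "U = c + \<pi> * (g * poly r (inverse v))"
    by (simp add: U_def r pole)
  have UO: "U \<in> \<O>"
    unfolding U c using coeffs rO pole uniformizer by (auto intro!: add mult)
  have Unit: "\<not> (\<exists>y\<in>\<O>. U = \<pi> * y)"
  proof
    assume "\<exists>y\<in>\<O>. U = \<pi> * y"
    then obtain y where y: "y \<in> \<O>" "U = \<pi> * y" by blast
    then have "c = \<pi> * (y - g * poly r (inverse v))"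
      using U by (simp add: algebra_simps)
    then have "inverse \<pi> = inverse c * (y - g * poly r (inverse v))"
      using \<open>p \<noteq> 0\<close> c uniformizer by (simp add: field_simps)
    moreover have "\<dots> \<in> \<O>"
      using lead c y rO pole by (auto intro!: mult diff)
    ultimately show False using uniformizer by simp
  qed
  then have U0: "U \<noteq> 0" by (metis mult_zero_right zero)
  have eq: "U = inverse v ^ degree p * poly p v"
    unfolding U_def using poly_reflect_poly_nz[of "inverse v" p] pole(3) by simp
  show nz: "poly p v \<noteq> 0" using U0 eq by auto
  have "inverse (poly p v) = inverse v ^ degree p * inverse U"
    using eq U0 nz pole(3) by (simp add: field_simps)
  then have "inverse (poly p v) = \<pi> ^ degree p * (g ^ degree p * inverse U)"
    using pole by (simp add: power_mult_distrib)
  then show "\<exists>y\<in>\<O>. inverse (poly p v) = \<pi> ^ degree p * y"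
    using inverse_mem[OF UO Unit] pole by (auto intro!: mult power)
qed

text \<open>A pole of order at least \<open>degree p\<close> can be cleared by
  \<open>\<pi> ^ e\<close> only if \<open>e\<close> is at least \<open>degree p\<close>.\<close>

lemma degree_le_of_poly_at_pole:
  assumes "\<And>i. coeff p i \<in> \<O>" "inverse (lead_coeff p) \<in> \<O>" "p \<noteq> 0"
    and "inverse v = \<pi> * g" "g \<in> \<O>" "v \<noteq> 0"
    and "\<pi> ^ e * poly p v \<in> \<O>"
  shows "degree p \<le> e"
proof -
  obtain y where y: "y \<in> \<O>" "inverse (poly p v) = \<pi> ^ degree p * y" and nz: "poly p v \<noteq> 0"
    using inverse_poly_at_pole[OF assms(1-6)] by blast
  have "\<pi> ^ e = (\<pi> ^ e * poly p v) * inverse (poly p v)"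
    using nz by simp
  also have "\<dots> = \<pi> ^ degree p * ((\<pi> ^ e * poly p v) * y)"
    unfolding y by (simp add: algebra_simps)
  finally show ?thesis
    by (rule uniformizer_power) (use assms y in \<open>auto intro!: mult\<close>)
qed

text \<open>The term of degree \<open>i\<close> uses up only \<open>\<pi> ^ i\<close> of the
  available factor, because \<open>x\<close> has at most a simple pole.\<close>

lemma power_mult_poly_mem:
  assumes "\<And>i. coeff p i \<in> \<O>" "\<pi> * x \<in> \<O>"
  shows "\<pi> ^ degree p * poly p x \<in> \<O>"
proof -
  have "\<pi> ^ degree p * poly p x =
      (\<Sum>i\<le>degree p. coeff p i * (\<pi> * x) ^ i * \<pi> ^ (degree p - i))"
    unfolding poly_altdef sum_distrib_left
  proof (intro sum.cong refl)
    fix i assume "i \<in> {..degree p}"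
    then have "\<pi> ^ degree p = \<pi> ^ i * \<pi> ^ (degree p - i)" by (simp flip: power_add)
    then show "\<pi> ^ degree p * (coeff p i * x ^ i) =
        coeff p i * (\<pi> * x) ^ i * \<pi> ^ (degree p - i)"
      by (simp add: power_mult_distrib)
  qed
  also have "\<dots> \<in> \<O>"
    using assms uniformizer by (auto intro!: sum mult[of _ "_ ^ _"] mult[of _ "(_ * _) ^ _"] power)
  finally show ?thesis .
qed

section \<open>Logarithmic derivatives and the logarithmic Jacobian\<close>

lemma log_deriv_power:
  assumes "derivation d" "x \<noteq> (0::'a)"
  shows "d (x ^ m) / x ^ m = of_nat m * (d x / x)"
proof -
  interpret d: derivation d by fact
  show ?thesis
    using assms(2) by (induction m) (simp_all add: d.mult field_simps)
qed

text \<open>Taking logarithmic derivatives in \<open>decomp\<close> turns the valuation into the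
  coefficient \<open>k\<close>. Neither \<open>k\<close> nor the unit \<open>z\<close> depends on
  \<open>d\<close>, so one choice serves all columns of a Jacobian matrix.\<close>

lemma log_deriv_decomp:
  assumes "x \<noteq> 0"
  shows "\<exists>k::int. \<exists>z\<in>\<O>. z \<noteq> 0 \<and> inverse z \<in> \<O> \<and>
    (\<forall>d. derivation d \<longrightarrow> d x / x = of_int k * (d \<pi> / \<pi>) + d z / z)"
proof -
  obtain m n z where z: "z \<noteq> 0" "z \<in> \<O>" "inverse z \<in> \<O>" "x * \<pi> ^ m = \<pi> ^ n * z"
    using decomp[OF assms] by blast
  have "d x / x = of_int (int n - int m) * (d \<pi> / \<pi>) + d z / z" if d: "derivation d" for d
  proof -
    interpret d: derivation d by fact
    have log: "d (a * b) / (a * b) = d a / a + d b / b" if "a \<noteq> 0" "b \<noteq> 0" for a b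
      using that by (simp add: d.mult field_simps)
    have "d x / x + of_nat m * (d \<pi> / \<pi>) = of_nat n * (d \<pi> / \<pi>) + d z / z"
      using log[of x "\<pi> ^ m"] log[of "\<pi> ^ n" z] z assms uniformizer
      by (simp only: log_deriv_power[OF d uniformizer(2)] z(4) power_eq_0_iff simp_thms)
    then show ?thesis by (simp add: algebra_simps)
  qed
  then show ?thesis using z by blast
qed

text \<open>By \<open>log_deriv_decomp\<close> the matrix is the rank-one matrix with entries
  \<open>of_int (k i) * (D j \<pi> / \<pi>)\<close> plus the matrix of the
  \<open>D j (z i) / z i\<close>, which lie in the ring. Hence a single \<open>c\<close> clearing
  the poles of the \<open>D j \<pi> / \<pi>\<close> suffices, whatever the size of the
  matrix.\<close>

lemma log_jacobian_mem:
  fixes D :: "'n::finite \<Rightarrow> 'a \<Rightarrow> 'a" and Y :: "'n \<Rightarrow> 'a"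
  assumes D: "\<And>j. derivation (D j)" "\<And>j x. x \<in> \<O> \<Longrightarrow> D j x \<in> \<O>"
    and Y: "\<And>i. Y i \<noteq> 0" and c: "c \<in> \<O>" "\<And>j. c * (D j \<pi> / \<pi>) \<in> \<O>"
  shows "c * det (\<chi> i j. D j (Y i) / Y i) \<in> \<O>"
proof -
  have "\<forall>i. \<exists>k z. z \<in> \<O> \<and> z \<noteq> 0 \<and> inverse z \<in> \<O> \<and>
      (\<forall>d. derivation d \<longrightarrow> d (Y i) / Y i = of_int k * (d \<pi> / \<pi>) + d z / z)"
    using log_deriv_decomp[OF Y] by blast
  then obtain k :: "'n \<Rightarrow> int" and z where z: "\<And>i. z i \<in> \<O>" "\<And>i. z i \<noteq> 0" "\<And>i. inverse (z i) \<in> \<O>"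
    and eq: "\<And>i d. derivation d \<Longrightarrow> d (Y i) / Y i = of_int (k i) * (d \<pi> / \<pi>) + d (z i) / z i"
    by metis
  have "c * det (\<chi> i j. of_int (k i) * (D j \<pi> / \<pi>) + D j (z i) / z i) \<in> \<O>"
    using z D(2) c by (intro mult_det_rank_one_mem of_int) (auto simp: divide_inverse intro!: mult)
  then show ?thesis
    by (simp add: eq[OF D(1)])
qed

end

subsection \<open>The places of a rational function field in one variable\<close>

text \<open>Strong induction on the degree: an irreducible polynomial over a field is prime, and a
  reducible one has a factor of smaller positive degree.\<close>

lemma ex_prime_dvd_poly:
  fixes Q :: "'c::field poly"
  assumes "degree Q > 0"
  shows "\<exists>q. prime_elem q \<and> q dvd Q"
  using assms
proof (induction "degree Q" arbitrary: Q rule: less_induct)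
  case less
  show ?case
  proof (cases "irreducible Q")
    case True
    then show ?thesis by (intro exI[of _ Q] conjI field_poly_irreducible_imp_prime dvd_refl)
  next
    case False
    have "Q \<noteq> 0" "\<not> is_unit Q"
      using less.prems is_unit_iff_degree[of Q] by (metis degree_0 less_irrefl)+
    then obtain a b where ab: "Q = a * b" "\<not> is_unit a" "\<not> is_unit b"
      using False by (auto simp: irreducible_def)
    then have "a \<noteq> 0" "b \<noteq> 0" using \<open>Q \<noteq> 0\<close> by auto
    then have "degree a > 0" "degree b > 0"
      using ab is_unit_iff_degree by auto
    then have "degree a < degree Q"
      using ab \<open>a \<noteq> 0\<close> \<open>b \<noteq> 0\<close> by (simp add: degree_mult_eq)
    then obtain q where "prime_elem q" "q dvd a"
      using less.hyps \<open>degree a > 0\<close> by blast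
    then show ?thesis using ab by auto
  qed
qed

text \<open>Each division by \<open>q\<close> lowers the degree, so the process stops.\<close>

lemma prime_power_decomp_poly:
  fixes q :: "'c::field poly"
  assumes "prime_elem q" "P \<noteq> 0"
  shows "\<exists>n P'. P = q ^ n * P' \<and> \<not> q dvd P'"
  using assms(2)
proof (induction "degree P" arbitrary: P rule: less_induct)
  case less
  show ?case
  proof (cases "q dvd P")
    case True
    then obtain R where R: "P = q * R" by (auto elim: dvdE)
    have "q \<noteq> 0" "\<not> is_unit q" using assms(1) by auto
    then have "degree R < degree P"
      using R less.prems by (simp add: degree_mult_eq is_unit_iff_degree)
    then obtain n P' where "R = q ^ n * P'" "\<not> q dvd P'"
      using less.hyps[of R] less.prems R by auto
    then have "P = q ^ Suc n * P'" "\<not> q dvd P'" using R by auto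
    then show ?thesis by blast
  next
    case False
    then have "P = q ^ 0 * P" "\<not> q dvd P" by auto
    then show ?thesis by blast
  qed
qed

lemma Fract_power: "Fract P Q ^ n = Fract (P ^ n) (Q ^ n :: 'a::idom)"
  by (induction n) (simp_all add: fract_expand)

lemma Fract_eq_0_iff: "Q \<noteq> 0 \<Longrightarrow> Fract P Q = 0 \<longleftrightarrow> P = 0"
  by (simp add: Zero_fract_def eq_fract)

text \<open>The localization at the ideal generated by \<open>q\<close>, as a subset of the field of
  fractions.\<close>

definition prime_place :: "'a::idom \<Rightarrow> 'a fract set" where
  "prime_place q = {x. \<exists>P Q. \<not> q dvd Q \<and> x = Fract P Q}"

lemma prime_placeI: "\<not> q dvd Q \<Longrightarrow> Fract P Q \<in> prime_place q"
  by (auto simp: prime_place_def)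

lemma prime_placeE:
  assumes "x \<in> prime_place q"
  obtains P Q where "\<not> q dvd Q" "Q \<noteq> 0" "x = Fract P Q"
  using assms unfolding prime_place_def by fastforce

lemma Fract_1_mem_prime_place: "prime_elem q \<Longrightarrow> Fract P 1 \<in> prime_place q"
  by (rule prime_placeI) (rule prime_elem_not_unit)

text \<open>For \<open>decomp\<close> the powers of \<open>q\<close> are split off the numerator
  (exponent \<open>n\<close>) and the denominator (exponent \<open>m\<close>); the cofactors form a
  unit because \<open>q\<close> divides neither.\<close>

lemma dvr_prime_place:
  fixes q :: "'c::field poly"
  assumes q: "prime_elem q"
  shows "dvr (prime_place q) (Fract q 1)"
proof
  have q0: "q \<noteq> 0" "\<not> q dvd 1" using q by auto
  show "1 \<in> prime_place q"
    using Fract_1_mem_prime_place[OF q, of 1] by (simp add: fract_collapse)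
  show "Fract q 1 \<in> prime_place q"
    by (rule Fract_1_mem_prime_place[OF q])
  show "Fract q 1 \<noteq> 0"
    using q0 by (simp add: Fract_eq_0_iff)
  show "- x \<in> prime_place q" if "x \<in> prime_place q" for x
    using that by (elim prime_placeE) (auto intro: prime_placeI)
  fix x y assume "x \<in> prime_place q" "y \<in> prime_place q"
  then obtain P Q R S where *: "\<not> q dvd Q" "Q \<noteq> 0" "x = Fract P Q"
    "\<not> q dvd S" "S \<noteq> 0" "y = Fract R S"
    by (elim prime_placeE)
  then have "\<not> q dvd Q * S"
    using q by (simp add: prime_elem_dvd_mult_iff)
  then show "x + y \<in> prime_place q" "x * y \<in> prime_place q"
    using * by (auto intro: prime_placeI)
next
  have q0: "q \<noteq> 0" "\<not> q dvd 1" using q by auto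
  show "inverse (Fract q 1) \<notin> prime_place q"
  proof
    assume "inverse (Fract q 1) \<in> prime_place q"
    then obtain P Q where "\<not> q dvd Q" "Q \<noteq> 0" "Fract 1 q = Fract P Q"
      by (auto elim: prime_placeE)
    then have "Q = q * P" using q0 by (simp add: eq_fract)
    then show False using \<open>\<not> q dvd Q\<close> by auto
  qed
  fix x :: "'c poly fract" assume "x \<noteq> 0"
  obtain P Q where x: "x = Fract P Q" "Q \<noteq> 0" by (cases x) auto
  then have "P \<noteq> 0" using \<open>x \<noteq> 0\<close> by (auto simp: fract_collapse)
  obtain n P' where P: "P = q ^ n * P'" "\<not> q dvd P'"
    using prime_power_decomp_poly[OF q \<open>P \<noteq> 0\<close>] by blast
  obtain m Q' where Q: "Q = q ^ m * Q'" "\<not> q dvd Q'"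
    using prime_power_decomp_poly[OF q \<open>Q \<noteq> 0\<close>] by blast
  have "P' \<noteq> 0" "Q' \<noteq> 0" using P Q by auto
  show "\<exists>m n z. z \<noteq> 0 \<and> z \<in> prime_place q \<and> inverse z \<in> prime_place q \<and>
      x * Fract q 1 ^ m = Fract q 1 ^ n * z"
  proof (intro exI conjI)
    show "x * Fract q 1 ^ m = Fract q 1 ^ n * Fract P' Q'"
      using x P Q q0 \<open>Q' \<noteq> 0\<close> by (simp add: Fract_power eq_fract algebra_simps)
  qed (use P Q \<open>P' \<noteq> 0\<close> \<open>Q' \<noteq> 0\<close> in \<open>auto simp: Fract_eq_0_iff intro: prime_placeI\<close>)
qed

text \<open>The quotient rule squares the denominator, and a prime not dividing \<open>Q\<close>
  does not divide \<open>Q * Q\<close>.\<close>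

lemma fract_deriv_prime_place:
  fixes q :: "'a::idom"
  assumes q: "prime_elem q" and d: "derivation d" and x: "x \<in> prime_place q"
  shows "fract_deriv d x \<in> prime_place q"
proof -
  obtain P Q where *: "\<not> q dvd Q" "Q \<noteq> 0" "x = Fract P Q"
    using x by (rule prime_placeE)
  then have "\<not> q dvd Q * Q"
    using q by (simp add: prime_elem_dvd_mult_iff)
  then show ?thesis
    using * by (auto simp: fract_deriv_Fract[OF d] intro: prime_placeI)
qed

text \<open>The valuation ring of denominator degree minus numerator degree, that is, the rational
  functions regular at infinity.\<close>

definition infinite_place :: "'c::field poly fract set" where
  "infinite_place = {x. \<exists>P Q. Q \<noteq> 0 \<and> degree P \<le> degree Q \<and> x = Fract P Q}"

lemma infinite_placeI: "Q \<noteq> 0 \<Longrightarrow> degree P \<le> degree Q \<Longrightarrow> Fract P Q \<in> infinite_place"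
  by (auto simp: infinite_place_def)

lemma infinite_placeE:
  assumes "x \<in> infinite_place"
  obtains P Q where "Q \<noteq> 0" "degree P \<le> degree Q" "x = Fract P Q"
  using assms unfolding infinite_place_def by blast

lemma dvr_infinite_place: "dvr (infinite_place :: 'c::field poly fract set) (Fract 1 [:0, 1:])"
proof
  show "1 \<in> (infinite_place :: 'c poly fract set)"
    unfolding One_fract_def by (rule infinite_placeI) auto
  show "Fract 1 [:0, 1:] \<in> (infinite_place :: 'c poly fract set)"
    by (rule infinite_placeI) auto
  show "Fract 1 [:0, 1:] \<noteq> (0 :: 'c poly fract)"
    by (simp add: Fract_eq_0_iff)
  show "- x \<in> infinite_place" if "x \<in> infinite_place" for x :: "'c poly fract"
    using that by (elim infinite_placeE) (auto intro: infinite_placeI)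
  fix x y :: "'c poly fract" assume "x \<in> infinite_place" "y \<in> infinite_place"
  then obtain P Q R S where *: "Q \<noteq> 0" "degree P \<le> degree Q" "x = Fract P Q"
    "S \<noteq> 0" "degree R \<le> degree S" "y = Fract R S"
    by (elim infinite_placeE)
  have "degree (P * S) \<le> degree (Q * S)" "degree (R * Q) \<le> degree (Q * S)"
    "degree (P * R) \<le> degree (Q * S)"
    using * degree_mult_le[of P S] degree_mult_le[of R Q] degree_mult_le[of P R]
    by (auto simp: degree_mult_eq)
  then show "x + y \<in> infinite_place" "x * y \<in> infinite_place"
    using * by (auto intro!: infinite_placeI degree_add_le)
next
  show "inverse (Fract 1 [:0, 1:]) \<notin> (infinite_place :: 'c poly fract set)"
  proof
    assume "inverse (Fract 1 [:0, 1:]) \<in> (infinite_place :: 'c poly fract set)"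
    then obtain P Q :: "'c poly" where *: "Q \<noteq> 0" "degree P \<le> degree Q" "Fract [:0, 1:] 1 = Fract P Q"
      by (auto elim: infinite_placeE)
    then have "[:0, 1:] * Q = P" by (simp only: eq_fract one_neq_zero not_False_eq_True) simp
    then have "degree P = Suc (degree Q)" using * by (auto simp: degree_mult_eq)
    then show False using * by simp
  qed
  fix x :: "'c poly fract" assume "x \<noteq> 0"
  obtain P Q where x: "x = Fract P Q" "Q \<noteq> 0" by (cases x) auto
  then have "P \<noteq> 0" using \<open>x \<noteq> 0\<close> by (auto simp: fract_collapse)
  let ?X = "[:0, 1:] :: 'c poly"
  \<comment> \<open>The crossed powers of the variable equalize the degrees of numerator and
    denominator, which makes \<open>?z\<close> a unit at infinity.\<close>
  let ?z = "Fract (P * ?X ^ degree Q) (Q * ?X ^ degree P)"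
  have deg: "degree (P * ?X ^ degree Q) = degree (Q * ?X ^ degree P)"
    using x \<open>P \<noteq> 0\<close> by (simp add: degree_mult_eq degree_power_eq)
  have nz: "P * ?X ^ degree Q \<noteq> 0" "Q * ?X ^ degree P \<noteq> 0"
    using x \<open>P \<noteq> 0\<close> by auto
  show "\<exists>m n z. z \<noteq> 0 \<and> z \<in> infinite_place \<and> inverse z \<in> infinite_place \<and>
      x * Fract 1 ?X ^ m = Fract 1 ?X ^ n * z"
  proof (intro exI conjI)
    show "x * Fract 1 ?X ^ degree P = Fract 1 ?X ^ degree Q * ?z"
      using x nz unfolding Fract_power x mult_fract
      by (subst eq_fract) (auto simp del: mult_pCons_left mult_pCons_right simp: algebra_simps)
    show "?z \<noteq> 0" using nz by (simp only: Fract_eq_0_iff not_False_eq_True)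
    show "?z \<in> infinite_place" using nz deg by (intro infinite_placeI) auto
    show "inverse ?z \<in> infinite_place" using nz deg by (simp only: inverse_fract) (intro infinite_placeI, auto)
  qed
qed

lemma fract_deriv_infinite_place:
  fixes x :: "'c::field poly fract"
  assumes d: "derivation d" and deg: "\<And>P. degree (d P) \<le> degree P" and x: "x \<in> infinite_place"
  shows "fract_deriv d x \<in> infinite_place"
proof -
  obtain P Q where *: "Q \<noteq> 0" "degree P \<le> degree Q" "x = Fract P Q"
    using x by (rule infinite_placeE)
  have "degree (d P * Q) \<le> degree (Q * Q)" "degree (P * d Q) \<le> degree (Q * Q)"
    using * deg[of P] deg[of Q] degree_mult_le[of "d P" Q] degree_mult_le[of P "d Q"]
    by (auto simp: degree_mult_eq)
  then show ?thesis
    using * by (auto simp: fract_deriv_Fract[OF d] intro!: infinite_placeI degree_diff_le)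
qed

text \<open>A nonconstant rational function has a pole: at a prime factor of its reduced
  denominator, or at infinity if it is a polynomial. A pole at a place is stated as
  \<open>inverse v\<close> being a multiple of the uniformizer.\<close>

lemma pole_cases:
  fixes v :: "'c::field poly fract"
  assumes "v \<notin> range (\<lambda>c. Fract [:c:] 1)"
  shows "(\<exists>q. prime_elem q \<and> (\<exists>g\<in>prime_place q. inverse v = Fract q 1 * g)) \<or>
    (\<exists>g\<in>infinite_place. inverse v = Fract 1 [:0, 1:] * g)"
proof -
  define R where "R = (\<lambda>Q. Q \<noteq> 0 \<and> (\<exists>P. v = Fract P Q))"
  have "\<exists>Q. R Q" unfolding R_def by (cases v) auto
  \<comment> \<open>Least degree of the denominator stands in for coprimality: a common prime factor
    could be cancelled.\<close>
  then obtain Q where "R Q" and min: "\<And>Q'. degree Q' < degree Q \<Longrightarrow> \<not> R Q'"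
    using exists_least_iff[of "\<lambda>n. \<exists>Q. R Q \<and> degree Q = n"] by metis
  then obtain P where v: "Q \<noteq> 0" "v = Fract P Q" by (auto simp: R_def)
  show ?thesis
  proof (cases "degree Q > 0")
    case True
    then obtain q where q: "prime_elem q" "q dvd Q" using ex_prime_dvd_poly by blast
    then obtain S where S: "Q = q * S" by (auto elim: dvdE)
    have q0: "q \<noteq> 0" "degree q > 0" "S \<noteq> 0" using q S v by (auto simp flip: is_unit_iff_degree intro: gr0I)
    have "\<not> q dvd P"
    proof
      assume "q dvd P"
      then obtain P' where "P = q * P'" by (auto elim: dvdE)
      then have "v = Fract P' S" using v S q0 by (simp add: eq_fract)
      then have "R S" using q0 by (auto simp: R_def)
      moreover have "degree S < degree Q" using S q0 by (simp add: degree_mult_eq)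
      ultimately show False using min by blast
    qed
    moreover have "inverse v = Fract q 1 * Fract S P"
      using v S by simp
    ultimately show ?thesis using q by (blast intro: prime_placeI)
  next
    case False
    then obtain c where c: "Q = [:c:]" by (auto elim: degree_eq_zeroE)
    then have "c \<noteq> 0" using v by auto
    have "degree P > 0"
    proof (rule ccontr)
      assume "\<not> degree P > 0"
      then obtain a where "P = [:a:]" by (auto elim: degree_eq_zeroE)
      then have "v = Fract [:a / c:] 1"
        using v c \<open>c \<noteq> 0\<close> by (simp add: eq_fract)
      then show False using assms by blast
    qed
    then have "P \<noteq> 0" by auto
    \<comment> \<open>Here \<open>Q\<close> is a nonzero constant, so the second numerator has
      degree 1, at most \<open>degree P\<close>.\<close>
    then have "inverse v = Fract 1 [:0, 1:] * Fract (Q * [:0, 1:]) P"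
      using v by (simp add: eq_fract)
    moreover have "Fract (Q * [:0, 1:]) P \<in> infinite_place"
      using c \<open>degree P > 0\<close> by (intro infinite_placeI) auto
    ultimately show ?thesis by blast
  qed
qed

subsection \<open>Euler operators and a distinguished variable\<close>

text \<open>The operator \<open>t_i d/dt_i\<close>. Monomials are its eigenvectors, with the
  exponent of \<open>t_i\<close> as eigenvalue, and the added factor \<open>t_i\<close> is what
  absorbs the product of the variables in \<open>a\<close>.\<close>

definition euler :: "'n \<Rightarrow> ('n::linorder, 'k::field) polyfun \<Rightarrow> ('n, 'k) polyfun" where
  "euler i P = Poly_Mapping.single (Poly_Mapping.single i 1) 1 * poly_pderiv i P"

lemma derivation_poly_pderiv: "derivation (poly_pderiv i :: ('n::linorder, 'k::field) polyfun \<Rightarrow> _)"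
  by standard (rule poly_pderiv_add poly_pderiv_mult)+

lemma derivation_euler: "derivation (euler i :: ('n::linorder, 'k::field) polyfun \<Rightarrow> _)"
  unfolding euler_def by (rule derivation_mult_left[OF derivation_poly_pderiv])

lemma euler_add: "euler i (P + Q) = euler i P + euler i Q"
  by (rule derivation.add[OF derivation_euler])

lemma euler_0 [simp]: "euler i 0 = 0"
  by (rule derivation.zero[OF derivation_euler])

lemma euler_single:
  "euler i (Poly_Mapping.single m c) = Poly_Mapping.single m (of_nat (Poly_Mapping.lookup m i) * c)"
proof (cases "Poly_Mapping.lookup m i = 0")
  case False
  then have "Poly_Mapping.single i 1 + (m - Poly_Mapping.single i 1) = m"
    by (intro poly_mapping_eqI) (auto simp: lookup_add lookup_minus lookup_single when_def)
  then show ?thesis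
    by (simp add: euler_def poly_pderiv_single mult_single)
qed (simp add: euler_def poly_pderiv_single)

lemma lookup_euler:
  "Poly_Mapping.lookup (euler i P) m = of_nat (Poly_Mapping.lookup m i) * Poly_Mapping.lookup P m"
proof (induction P rule: polyfun_induct)
  case (single l c)
  then show ?case by (simp add: euler_single lookup_single when_def)
qed (simp_all add: euler_add lookup_add algebra_simps)

lemma fract_deriv_euler:
  "fract_deriv (euler i) (x :: ('n::linorder, 'k::field) ratfun) = ratfun_var i * ratfun_pderiv i x"
proof -
  obtain P Q where x: "x = Fract P Q" "Q \<noteq> 0" by (cases x) auto
  then show ?thesis
    by (simp add: fract_deriv_Fract[OF derivation_euler] ratfun_pderiv_Fract ratfun_var_def euler_def
        algebra_simps)
qed

text \<open>A representation with fewest monomials in the denominator has a one-term denominator: for a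
  monomial \<open>l\<close> of the denominator, applying \<open>euler i - l\<^sub>i\<close> to numerator and
  denominator gives another representation, without \<open>l\<close>.\<close>

lemma ratfun_const_if_euler_eq_0:
  fixes v :: "('n::linorder, 'k::field_char_0) ratfun"
  assumes "\<And>i. fract_deriv (euler i) v = 0"
  shows "v \<in> range ratfun_const"
proof -
  have "v \<in> range ratfun_const" if "v = Fract P Q" "Q \<noteq> 0" for P Q
    using that
  proof (induction "card (Poly_Mapping.keys Q)" arbitrary: P Q rule: less_induct)
    case less
    have eq: "euler i P * Q = P * euler i Q" for i
      using assms[of i] less.prems
      by (simp add: fract_deriv_Fract[OF derivation_euler] Fract_eq_0_iff)
    obtain l where l: "l \<in> Poly_Mapping.keys Q"
      using less.prems by (metis ex_in_conv keys_eq_empty)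
    define T where "T = (\<lambda>i (R :: ('n, 'k) polyfun). euler i R - of_nat (Poly_Mapping.lookup l i) * R)"
    have lookup_T: "Poly_Mapping.lookup (T i R) m =
        (of_nat (Poly_Mapping.lookup m i) - of_nat (Poly_Mapping.lookup l i)) * Poly_Mapping.lookup R m" for i R m
    proof -
      have "Poly_Mapping.lookup (of_nat c * R) m = of_nat c * Poly_Mapping.lookup R m" for c
        by (induction c) (simp_all add: lookup_add algebra_simps)
      then show ?thesis
        by (simp add: T_def lookup_minus lookup_euler algebra_simps)
    qed
    \<comment> \<open>Subtracting the same multiple of \<open>P * Q\<close> from both sides of
      \<open>eq\<close> keeps the proportionality.\<close>
    have T_eq: "T i P * Q = P * T i Q" for i
      using eq[of i] by (simp add: T_def algebra_simps)
    show ?case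
    proof (cases "\<exists>i. T i Q \<noteq> 0")
      case True
      then obtain i where i: "T i Q \<noteq> 0" by blast
      have "Poly_Mapping.keys (T i Q) \<subset> Poly_Mapping.keys Q"
        using l by (auto simp: in_keys_iff lookup_T)
      then have "card (Poly_Mapping.keys (T i Q)) < card (Poly_Mapping.keys Q)"
        by (intro psubset_card_mono) auto
      moreover have "v = Fract (T i P) (T i Q)"
        using less.prems i T_eq[of i] by (simp add: eq_fract)
      ultimately show ?thesis
        using less.hyps i by blast
    next
      case False
      then have Q0: "T i Q = 0" for i by blast
      then have P0: "T i P = 0" for i
        using T_eq[of i] less.prems by simp
      \<comment> \<open>A monomial other than \<open>l\<close> differs from it in some exponent; in
        characteristic 0 the eigenvalue of \<open>T i\<close> on it is then nonzero, so its
        coefficient vanishes. Thus \<open>P\<close> and \<open>Q\<close> are both multiples of the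
        monomial \<open>l\<close>.\<close>
      have single: "R = Poly_Mapping.single l (Poly_Mapping.lookup R l)" if "\<And>i. T i R = 0" for R
      proof (rule poly_mapping_eqI)
        fix m
        show "Poly_Mapping.lookup R m =
            Poly_Mapping.lookup (Poly_Mapping.single l (Poly_Mapping.lookup R l)) m"
        proof (cases "m = l")
          case False
          then obtain i where "Poly_Mapping.lookup m i \<noteq> Poly_Mapping.lookup l i"
            by (metis poly_mapping_eqI)
          moreover have "Poly_Mapping.lookup (T i R) m = 0"
            using that by simp
          ultimately show ?thesis
            using False by (simp add: lookup_T lookup_single)
        qed simp
      qed
      define a b where "a = Poly_Mapping.lookup P l" and "b = Poly_Mapping.lookup Q l"
      have P: "P = Poly_Mapping.single l a" and Q: "Q = Poly_Mapping.single l b"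
        using single[OF P0] single[OF Q0] by (simp_all add: a_def b_def)
      have "b \<noteq> 0" using l by (simp add: b_def in_keys_iff)
      then have "P * 1 = Poly_Mapping.single 0 (a / b) * Q"
        by (simp add: P Q mult_single)
      then have "v = ratfun_const (a / b)"
        using less.prems by (simp add: ratfun_const_def eq_fract)
      then show ?thesis by blast
    qed
  qed
  then show ?thesis by (cases v) auto
qed

text \<open>Reads \<open>P\<close> as a polynomial in \<open>t_j\<close> over the other variables.
  The update deletes \<open>t_j\<close> from each monomial; the coefficients are kept in the full
  field \<open>ratfun\<close> so that no type with fewer variables is involved.\<close>

definition separate_var :: "'n \<Rightarrow> ('n::linorder, 'k::field) polyfun \<Rightarrow> ('n, 'k) ratfun poly" where
  "separate_var j P = (\<Sum>m\<in>Poly_Mapping.keys P.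
     monom (Fract (Poly_Mapping.single (Poly_Mapping.update j 0 m) (Poly_Mapping.lookup P m)) 1)
       (Poly_Mapping.lookup m j))"

lemma separate_var_single:
  "separate_var j (Poly_Mapping.single m c) =
     monom (Fract (Poly_Mapping.single (Poly_Mapping.update j 0 m) c) 1) (Poly_Mapping.lookup m j)"
  by (cases "c = 0") (simp_all add: separate_var_def fract_collapse)

lemma separate_var_superset:
  assumes "finite A" "Poly_Mapping.keys P \<subseteq> A"
  shows "separate_var j P = (\<Sum>m\<in>A.
     monom (Fract (Poly_Mapping.single (Poly_Mapping.update j 0 m) (Poly_Mapping.lookup P m)) 1)
       (Poly_Mapping.lookup m j))"
  unfolding separate_var_def using assms
  by (intro sum.mono_neutral_left) (auto simp: in_keys_iff fract_collapse)

lemma separate_var_add: "separate_var j (P + Q) = separate_var j P + separate_var j Q"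
proof -
  let ?A = "Poly_Mapping.keys P \<union> Poly_Mapping.keys Q"
  have add1: "Fract (a + b) 1 = Fract a 1 + Fract b 1" for a b :: "('a, 'b) polyfun"
    by simp
  have "Poly_Mapping.keys (P + Q) \<subseteq> ?A"
    by (rule Poly_Mapping.keys_add)
  then show ?thesis
    by (simp add: separate_var_superset[of ?A] lookup_add single_add add1 sum.distrib
        del: add_fract flip: add_monom)
qed

lemma separate_var_0 [simp]: "separate_var j 0 = 0"
  by (simp add: separate_var_def)

lemma idom_hom_separate_var: "idom_hom (separate_var j :: ('n::linorder, 'k::field) polyfun \<Rightarrow> _)"
proof
  fix P Q :: "('n, 'k) polyfun"
  show "separate_var j (P + Q) = separate_var j P + separate_var j Q"
    by (rule separate_var_add)
  show "separate_var j (P * Q) = separate_var j P * separate_var j Q"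
  proof (induction P rule: polyfun_induct)
    case (single m c)
    show ?case
    proof (induction Q rule: polyfun_induct)
      case (single l d)
      have "Poly_Mapping.update j 0 (m + l) = Poly_Mapping.update j 0 m + Poly_Mapping.update j 0 l"
        by (intro poly_mapping_eqI) (simp add: lookup_update lookup_add)
      then show ?case
        by (simp add: mult_single separate_var_single mult_monom lookup_add)
    qed (simp_all add: separate_var_add distrib_left)
  qed (simp_all add: separate_var_add distrib_right)
next
  have "Poly_Mapping.update j 0 0 = (0 :: 'n \<Rightarrow>\<^sub>0 nat)"
    by (intro poly_mapping_eqI) (simp add: lookup_update)
  then show "separate_var j (1 :: ('n, 'k) polyfun) = 1"
    using separate_var_single[of j 0 "1 :: 'k"] by (simp add: fract_collapse)
qed

lemma single_power:
  "Poly_Mapping.single (Poly_Mapping.single i 1) (1 :: 'k::comm_semiring_1) ^ n =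
     Poly_Mapping.single (Poly_Mapping.single i n) 1"
  by (induction n) (simp_all add: mult_single flip: single_add)

text \<open>Putting \<open>t_j\<close> back for the new variable recovers \<open>P\<close>; this
  yields the injectivity in \<open>inj_hom_separate_var\<close>.\<close>

lemma poly_separate_var: "poly (separate_var j P) (ratfun_var j) = Fract P 1"
proof (induction P rule: polyfun_induct)
  case (single m c)
  have "Poly_Mapping.update j 0 m + Poly_Mapping.single j (Poly_Mapping.lookup m j) = m"
    by (intro poly_mapping_eqI) (simp add: lookup_update lookup_add lookup_single when_def)
  then show ?case
    by (simp add: separate_var_single poly_monom ratfun_var_def Fract_power single_power mult_single
        del: One_nat_def)
qed (simp_all add: separate_var_add fract_collapse)

definition separate_fract :: "'n \<Rightarrow> ('n::linorder, 'k::field) ratfun \<Rightarrow> ('n, 'k) ratfun poly fract" where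
  "separate_fract j = fract_lift (\<lambda>P. Fract (separate_var j P) 1)"

text \<open>The counterpart of \<open>euler i\<close> after \<open>t_j\<close> has become the
  polynomial variable \<open>s\<close>. For \<open>i = j\<close> it is \<open>s d/ds\<close>, which
  treats all coefficients as constants; otherwise it acts on the coefficients alone.\<close>

definition separate_euler ::
  "'n \<Rightarrow> 'n \<Rightarrow> ('n::linorder, 'k::field) ratfun poly \<Rightarrow> ('n, 'k) ratfun poly" where
  "separate_euler j i = (if i = j then (\<lambda>R. [:0, 1:] * pderiv R) else map_poly (fract_deriv (euler i)))"

lemma derivation_separate_euler:
  "derivation (separate_euler j i :: ('n::linorder, 'k::field) ratfun poly \<Rightarrow> _)"
  unfolding separate_euler_def
  using derivation_mult_left[OF derivation_pderiv]
    derivation_map_poly[OF derivation_fract_deriv[OF derivation_euler]]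
  by (simp only: split: if_split) blast

lemma degree_separate_euler_le: "degree (separate_euler j i R) \<le> degree R"
proof (cases "i = j")
  case False
  have "derivation (fract_deriv (euler i) :: ('a, 'b) ratfun \<Rightarrow> _)"
    by (rule derivation_fract_deriv[OF derivation_euler])
  then show ?thesis
    using False
    by (intro degree_le) (simp add: separate_euler_def coeff_map_poly_derivation coeff_eq_0 derivation.zero)
next
  case True
  then show ?thesis
    by (intro degree_le) (auto simp: separate_euler_def coeff_pCons coeff_pderiv coeff_eq_0 split: nat.split)
qed

text \<open>By additivity it is enough to compare monomials, where both sides multiply by the
  exponent of \<open>t_i\<close>: it is the degree in the new variable if \<open>i = j\<close>, and
  is left alone by the update otherwise.\<close>

lemma separate_euler_separate_var:
  "separate_euler j i (separate_var j P) = separate_var j (euler i P)"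
proof (induction P rule: polyfun_induct)
  case (single m c)
  have 1: "euler i (1 :: ('a, 'b) polyfun) = 0"
    by (rule derivation.one[OF derivation_euler])
  have 2: "fract_deriv (euler i) (0 :: ('a, 'b) ratfun) = 0"
    by (rule derivation.zero[OF derivation_fract_deriv[OF derivation_euler]])
  have add1: "Fract (a + b) 1 = Fract a 1 + Fract b 1" for a b :: "('a, 'b) polyfun"
    by simp
  have 3: "Fract (Poly_Mapping.single l (of_nat n * c)) 1 =
      of_nat n * Fract (Poly_Mapping.single l c) (1 :: ('a, 'b) polyfun)" for l n
    by (induction n) (simp_all add: add1 single_add ring_distribs fract_collapse del: add_fract)
  show ?case
  proof (cases "i = j")
    case True
    then show ?thesis
      by (cases "Poly_Mapping.lookup m j")
        (simp_all add: separate_euler_def separate_var_single euler_single pderiv_monom 3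
          fract_collapse del: of_nat_Suc flip: monom_Suc)
  next
    case False
    then show ?thesis
      by (simp add: separate_euler_def separate_var_single euler_single map_poly_monom
          fract_deriv_Fract[OF derivation_euler] 1 2 lookup_update)
  qed
qed (simp_all add: separate_var_add euler_add derivation.add[OF derivation_separate_euler]
       derivation.zero[OF derivation_separate_euler])

lemma inj_hom_separate_var:
  "inj_hom (\<lambda>P :: ('n::linorder, 'k::field) polyfun. Fract (separate_var j P) 1)"
proof -
  interpret idom_hom "separate_var j :: ('n, 'k) polyfun \<Rightarrow> _" by (rule idom_hom_separate_var)
  show ?thesis
  proof
    fix P :: "('n, 'k) polyfun"
    assume "Fract (separate_var j P) 1 = 0"
    then have "separate_var j P = 0" by (simp add: Fract_eq_0_iff)
    then have "Fract P 1 = 0" using poly_separate_var[of j P] by simp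
    then show "P = 0" by (simp add: Fract_eq_0_iff)
  qed (simp_all add: add mult one fract_collapse)
qed

lemma field_hom_separate_fract:
  "field_hom (separate_fract j :: ('n::linorder, 'k::field) ratfun \<Rightarrow> _)"
  unfolding separate_fract_def by (rule inj_hom.field_hom_lift[OF inj_hom_separate_var])

lemma separate_fract_Fract_1:
  "separate_fract j (Fract P 1) = Fract (separate_var j (P :: ('n::linorder, 'k::field) polyfun)) 1"
proof -
  interpret idom_hom "separate_var j :: ('n, 'k) polyfun \<Rightarrow> _" by (rule idom_hom_separate_var)
  show ?thesis
    by (simp add: separate_fract_def inj_hom.lift_Fract[OF inj_hom_separate_var] one fract_collapse)
qed

lemma separate_fract_const: "separate_fract j (ratfun_const c) = Fract [:ratfun_const c:] 1"
proof -
  have "Poly_Mapping.update j 0 0 = (0 :: 'a \<Rightarrow>\<^sub>0 nat)"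
    by (intro poly_mapping_eqI) (simp add: lookup_update)
  then show ?thesis
    by (simp add: ratfun_const_def separate_fract_Fract_1 separate_var_single monom_0)
qed

lemma separate_fract_var:
  "separate_fract j (ratfun_var i) = Fract (if i = j then [:0, 1:] else [:ratfun_var i:]) 1"
proof (cases "i = j")
  case True
  have "Poly_Mapping.update j 0 (Poly_Mapping.single j 1) = (0 :: 'a \<Rightarrow>\<^sub>0 nat)"
    by (intro poly_mapping_eqI) (simp add: lookup_update lookup_single when_def)
  then show ?thesis using True
    by (simp add: ratfun_var_def separate_fract_Fract_1 separate_var_single monom_Suc monom_0
        fract_collapse)
next
  case False
  then have "Poly_Mapping.update j 0 (Poly_Mapping.single i 1) = (Poly_Mapping.single i 1 :: 'a \<Rightarrow>\<^sub>0 nat)"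
    by (intro poly_mapping_eqI) (auto simp: lookup_update lookup_single when_def)
  then show ?thesis using False
    by (simp add: ratfun_var_def separate_fract_Fract_1 separate_var_single monom_0
        lookup_single)
qed

lemma fract_deriv_separate_fract:
  "fract_deriv (separate_euler j i) (separate_fract j x) = separate_fract j (fract_deriv (euler i) x)"
  unfolding separate_fract_def
proof (rule inj_hom.lift_deriv[OF inj_hom_separate_var derivation_euler
      derivation_fract_deriv[OF derivation_separate_euler]])
  fix P
  show "fract_deriv (separate_euler j i) (Fract (separate_var j P) 1) =
      Fract (separate_var j (euler i P)) 1"
    by (simp add: fract_deriv_Fract[OF derivation_separate_euler] separate_euler_separate_var
        derivation.one[OF derivation_separate_euler])
qed

subsection \<open>Substitution and the equation\<close>

text \<open>Algebraic independence is the triviality of the kernel of substitution.\<close>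

lemma inj_hom_poly_subst:
  fixes y :: "'n::{finite,linorder} \<Rightarrow> ('n, 'k::field) ratfun"
  assumes "alg_indep y"
  shows "inj_hom (poly_subst y)"
proof
  show "poly_subst y 1 = 1"
    using poly_subst_single[of y 0 1] by simp
  show "x = 0" if "poly_subst y x = 0" for x
    using assms that by (simp add: alg_indep_def)
qed (rule poly_subst_add poly_subst_mult)+

lemma ratfun_subst_eq_fract_lift:
  fixes y :: "'n::{finite,linorder} \<Rightarrow> ('n, 'k::field) ratfun"
  assumes "alg_indep y"
  shows "ratfun_subst y = fract_lift (poly_subst y)"
proof
  fix f :: "('n, 'k) ratfun"
  obtain P Q where f: "f = Fract P Q" "Q \<noteq> 0" by (cases f) auto
  then have "poly_subst y Q \<noteq> 0" using assms by (auto simp: alg_indep_def)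
  then show "ratfun_subst y f = fract_lift (poly_subst y) f"
    using f by (simp add: ratfun_subst_Fract inj_hom.lift_Fract[OF inj_hom_poly_subst[OF assms]])
qed

lemma field_hom_ratfun_subst: "alg_indep y \<Longrightarrow> field_hom (ratfun_subst y)"
  using inj_hom.field_hom_lift[OF inj_hom_poly_subst] by (simp add: ratfun_subst_eq_fract_lift)

lemma poly_subst_single_0: "poly_subst y (Poly_Mapping.single 0 c) = ratfun_const c"
  by (simp add: poly_subst_single)

lemma poly_subst_1 [simp]: "poly_subst y 1 = 1"
  using poly_subst_single_0[of y 1] by simp

lemma ratfun_subst_const: "ratfun_subst y (ratfun_const c) = ratfun_const c"
  unfolding ratfun_const_def[of c]
  by (subst ratfun_subst_Fract) (simp_all add: poly_subst_single_0 flip: ratfun_const_def)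

lemma poly_subst_var: "poly_subst y (Poly_Mapping.single (Poly_Mapping.single i 1) 1) = y i"
proof -
  have "(\<Prod>k\<in>UNIV. y k ^ Poly_Mapping.lookup (Poly_Mapping.single i 1) k) = (\<Prod>k\<in>UNIV. if k = i then y k else 1)"
    by (intro prod.cong) (auto simp: lookup_single when_def)
  then show ?thesis
    by (simp add: poly_subst_single del: One_nat_def)
qed

lemma ratfun_subst_var: "ratfun_subst y (ratfun_var i) = y i"
  unfolding ratfun_var_def by (subst ratfun_subst_Fract) (simp_all add: poly_subst_var del: One_nat_def)

text \<open>Substitution fixes constants and, as a homomorphism of fields, is injective.\<close>

lemma ratfun_subst_not_const:
  assumes "alg_indep y" "u \<notin> range ratfun_const"
  shows "ratfun_subst y u \<notin> range ratfun_const"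
proof
  interpret field_hom "ratfun_subst y" by (rule field_hom_ratfun_subst[OF assms(1)])
  assume "ratfun_subst y u \<in> range ratfun_const"
  then obtain c where "ratfun_subst y u = ratfun_const c" by blast
  then have "ratfun_subst y (u - ratfun_const c) = 0"
    by (simp add: diff ratfun_subst_const)
  then have "u = ratfun_const c"
    by (simp add: eq_0_iff)
  then show False using assms(2) by blast
qed

lemma alg_indep_neq_0:
  assumes "alg_indep y"
  shows "y i \<noteq> 0"
proof -
  have "Poly_Mapping.single (Poly_Mapping.single i 1) 1 \<noteq> (0 :: ('a, 'b) polyfun)"
    by (metis lookup_single_eq lookup_zero one_neq_zero)
  then show ?thesis
    using assms poly_subst_var[of y i] by (auto simp: alg_indep_def)
qed

lemma ratfun_var_neq_0: "ratfun_var i \<noteq> (0 :: ('n::linorder, 'k::field) ratfun)"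
proof -
  have "Poly_Mapping.single (Poly_Mapping.single i 1) 1 \<noteq> (0 :: ('n, 'k) polyfun)"
    by (metis lookup_single_eq lookup_zero one_neq_zero)
  then show ?thesis
    by (simp add: ratfun_var_def Fract_eq_0_iff)
qed

text \<open>Multiplying row \<open>i\<close> by \<open>y i\<close> removes the denominators, and
  then column \<open>l\<close> carries the common factor \<open>ratfun_var l\<close>.\<close>

lemma det_euler_eq:
  fixes y :: "'n::{finite,linorder} \<Rightarrow> ('n, 'k::field) ratfun"
  assumes "\<And>i. y i \<noteq> 0"
  shows "det (\<chi> i l. fract_deriv (euler l) (y i) / y i) * (\<Prod>i\<in>UNIV. y i) =
    (\<Prod>i\<in>UNIV. ratfun_var i) * jacobian_det y"
proof -
  let ?A = "\<lambda>i l. fract_deriv (euler l) (y i) / y i" and ?J = "\<chi> l i. ratfun_pderiv l (y i)"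
  have "(\<Prod>i\<in>UNIV. y i) * det (\<chi> i. \<chi> l. ?A i l) = det (\<chi> i. y i *s (\<chi> l. ?A i l))"
    by (rule det_rows_mul[symmetric])
  also have "(\<chi> i. y i *s (\<chi> l. ?A i l)) = transpose (\<chi> l. ratfun_var l *s (?J $ l))"
    using assms by (simp add: vec_eq_iff transpose_def fract_deriv_euler)
  also have "det \<dots> = (\<Prod>i\<in>UNIV. ratfun_var i) * det (\<chi> l. ?J $ l)"
    by (simp only: det_transpose det_rows_mul)
  also have "(\<chi> l. ?J $ l) = transpose (\<chi> i l. ratfun_pderiv l (y i))"
    by (simp add: vec_eq_iff transpose_def)
  also have "det \<dots> = jacobian_det y"
    by (simp only: det_transpose jacobian_det_def)
  finally show ?thesis by (simp add: mult.commute)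
qed

text \<open>The coefficients pass from the ground field through \<open>ratfun\<close> to constants
  of \<open>ratfun poly fract\<close>; this is the polynomial that \<open>separate_fract\<close>
  makes of \<open>map_poly ratfun_const p\<close>, for every \<open>j\<close>.\<close>

definition const_poly :: "'k::field poly \<Rightarrow> ('n::linorder, 'k) ratfun poly fract poly" where
  "const_poly p = map_poly (\<lambda>c. Fract [:ratfun_const c:] 1) p"

lemma coeff_const_poly: "coeff (const_poly p) i = Fract [:ratfun_const (coeff p i):] 1"
  by (simp add: const_poly_def coeff_map_poly fract_collapse)

lemma degree_const_poly: "degree (const_poly p) = degree p"
  unfolding const_poly_def by (rule degree_map_poly) (simp add: Fract_eq_0_iff)

lemma const_poly_eq_0_iff: "const_poly p = 0 \<longleftrightarrow> p = 0"
  unfolding poly_eq_iff[of "const_poly p"] poly_eq_iff[of p]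
  by (simp add: coeff_const_poly Fract_eq_0_iff)

lemma separate_fract_poly:
  fixes x :: "('n::linorder, 'k::field) ratfun"
  shows "separate_fract j (poly (map_poly ratfun_const p) x) = poly (const_poly p) (separate_fract j x)"
proof -
  interpret field_hom "separate_fract j :: ('n, 'k) ratfun \<Rightarrow> _" by (rule field_hom_separate_fract)
  have "map_poly (separate_fract j) (map_poly ratfun_const p) = const_poly p"
    by (simp add: poly_eq_iff coeff_map_poly zero coeff_const_poly separate_fract_const fract_collapse)
  then show ?thesis by (simp add: poly_map)
qed

text \<open>A place containing the constants of the ground field contains the inverse of the leading
  coefficient, so \<open>degree_le_of_poly_at_pole\<close> applies.\<close>

lemma degree_const_poly_le_at_pole:
  fixes p :: "'k::field poly" and v :: "('n::linorder, 'k) ratfun poly fract"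
  assumes "dvr \<O> \<pi>" and "\<And>c. Fract [:ratfun_const c:] 1 \<in> \<O>" and "p \<noteq> 0"
    and "inverse v = \<pi> * g" "g \<in> \<O>" "v \<noteq> 0"
    and "\<pi> ^ e * poly (const_poly p) v \<in> \<O>"
  shows "degree p \<le> e"
proof -
  let ?p = "const_poly p :: ('n, 'k) ratfun poly fract poly"
  have "inverse (ratfun_const (lead_coeff p) :: ('n, 'k) ratfun) = ratfun_const (inverse (lead_coeff p))"
    using \<open>p \<noteq> 0\<close> by (intro inverse_unique) (simp flip: ratfun_const_mult)
  then have "inverse (lead_coeff ?p) = Fract [:ratfun_const (inverse (lead_coeff p)):] 1"
    using \<open>p \<noteq> 0\<close> by (simp add: coeff_const_poly degree_const_poly eq_fract)
       (simp flip: ratfun_const_mult)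
  then have "inverse (lead_coeff ?p) \<in> \<O>"
    by (simp only: assms(2))
  then have "degree ?p \<le> e"
    using assms
    by (intro dvr.degree_le_of_poly_at_pole[OF assms(1) _ _ _ assms(4)])
      (auto simp: coeff_const_poly const_poly_eq_0_iff)
  then show ?thesis by (simp add: degree_const_poly)
qed

lemma const_mem_infinite_place: "Fract [:c:] 1 \<in> infinite_place"
  by (rule infinite_placeI) auto

lemma poly_ratfun_var_neq_0:
  fixes p :: "'k::field poly"
  assumes "degree p > 0"
  shows "poly (map_poly ratfun_const p) (ratfun_var i :: ('n::linorder, 'k) ratfun) \<noteq> 0"
proof
  interpret field_hom "separate_fract i :: ('n, 'k) ratfun \<Rightarrow> _" by (rule field_hom_separate_fract)
  let ?s = "Fract [:0, 1:] 1 :: ('n, 'k) ratfun poly fract"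
  assume "poly (map_poly ratfun_const p) (ratfun_var i :: ('n, 'k) ratfun) = 0"
  then have "poly (const_poly p) ?s = 0"
    using separate_fract_poly[of i p "ratfun_var i"] by (simp add: separate_fract_var zero)
  moreover have "subring_set (infinite_place :: ('n, 'k) ratfun poly fract set)"
    using dvr_infinite_place by (rule dvr.axioms)
  \<comment> \<open>The new variable has a pole at infinity with \<open>g = 1\<close>, while the
    value 0 is regular there; the pole bound is used with \<open>e = 0\<close>.\<close>
  ultimately have "degree p \<le> 0"
    using assms
    by (intro degree_const_poly_le_at_pole[OF dvr_infinite_place const_mem_infinite_place, of p ?s 1])
      (auto simp: subring_set.zero subring_set.one Fract_eq_0_iff)
  then show False using assms by simp
qed

theorem theorem7p6:
  fixes p p0 :: "'k::field_char_0 poly"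
    and h h0 :: nat
    and u a b :: "('n::{finite,linorder}, 'k) ratfun"
  assumes "CARD('n) \<ge> 2"
    and "degree p = h" and "h \<ge> 2"
    and "u \<notin> range ratfun_const"
    and "b = (\<Prod>i\<in>UNIV. ratfun_var i) * poly (map_poly ratfun_const p) u"
    and "degree p0 = h0" and "0 < h0" and "h0 < h"
    and "a = (\<Prod>i\<in>UNIV. ratfun_var i) * poly (map_poly ratfun_const p0) (ratfun_var (Min UNIV))"
  shows "\<not> jacobian_eq_has_solution a b"
proof
  assume "jacobian_eq_has_solution a b"
  then obtain y where y: "alg_indep y" "jacobian_det y = ratfun_subst y b / a"
    unfolding jacobian_eq_has_solution_def by blast
  let ?t1 = "ratfun_var (Min UNIV) :: ('n, 'k) ratfun"
  interpret subst: field_hom "ratfun_subst y" by (rule field_hom_ratfun_subst[OF y(1)])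
  define v where "v = ratfun_subst y u"
  define f where "f = det (\<chi> i l. fract_deriv (euler l) (y i) / y i)"
  have y0: "\<And>i. y i \<noteq> 0" by (rule alg_indep_neq_0[OF y(1)])

  have "map_poly (ratfun_subst y) (map_poly ratfun_const p) = map_poly ratfun_const p"
    by (simp add: poly_eq_iff coeff_map_poly subst.zero ratfun_subst_const)
  then have subst_b: "ratfun_subst y b = (\<Prod>i\<in>UNIV. y i) * poly (map_poly ratfun_const p) v"
    by (simp add: assms(5) subst.mult subst.prod subst.poly_map ratfun_subst_var v_def)
  have P0: "poly (map_poly ratfun_const p0) ?t1 \<noteq> 0"
    using poly_ratfun_var_neq_0 assms by blast
  \<comment> \<open>The product of the variables in \<open>a\<close> is what turns the Jacobian into
    \<open>f\<close>; the product of the \<open>y i\<close> coming from \<open>b\<close> is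
    cancelled afterwards.\<close>
  have "f * (\<Prod>i\<in>UNIV. y i) * poly (map_poly ratfun_const p0) ?t1 =
      a * jacobian_det y"
    using det_euler_eq[OF y0] by (simp add: f_def assms(9) mult.assoc mult.left_commute mult.commute)
  also have "\<dots> = (\<Prod>i\<in>UNIV. y i) * poly (map_poly ratfun_const p) v"
    using P0 by (simp add: y(2) subst_b assms(9) ratfun_var_neq_0)
  finally have "(\<Prod>i\<in>UNIV. y i) * (f * poly (map_poly ratfun_const p0) ?t1) =
      (\<Prod>i\<in>UNIV. y i) * poly (map_poly ratfun_const p) v"
    by (simp add: mult_ac)
  then have f_eq: "f * poly (map_poly ratfun_const p0) ?t1 = poly (map_poly ratfun_const p) v"
    using y0 by simp

  have "v \<notin> range ratfun_const"
    unfolding v_def by (rule ratfun_subst_not_const[OF y(1) assms(4)])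
  then obtain j where j: "fract_deriv (euler j) v \<noteq> 0"
    using ratfun_const_if_euler_eq_0 by blast
  interpret sep: field_hom "separate_fract j :: ('n, 'k) ratfun \<Rightarrow> _" by (rule field_hom_separate_fract)
  define D :: "'n \<Rightarrow> ('n, 'k) ratfun poly fract \<Rightarrow> _" where "D = (\<lambda>i. fract_deriv (separate_euler j i))"
  define V where "V = separate_fract j v"
  define Y where "Y = (\<lambda>i. separate_fract j (y i))"
  have D: "derivation (D i)" for i
    unfolding D_def by (rule derivation_fract_deriv[OF derivation_separate_euler])
  have Y0: "Y i \<noteq> 0" for i
    using y0 by (simp add: Y_def sep.eq_0_iff)
  have F: "separate_fract j f = det (\<chi> i l. D l (Y i) / Y i)"
    by (simp add: f_def sep.det sep.divide D_def Y_def fract_deriv_separate_fract)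
  have F_eq: "separate_fract j f * poly (const_poly p0) (separate_fract j ?t1) = poly (const_poly p) V"
    using arg_cong[OF f_eq, of "separate_fract j"]
    by (simp add: sep.mult separate_fract_poly V_def)
  have "D j V \<noteq> 0"
    using j by (simp add: D_def V_def fract_deriv_separate_fract sep.eq_0_iff)
  \<comment> \<open>Constants of the function field in \<open>s\<close> are killed by
    \<open>s d/ds\<close>, so \<open>V\<close> is not among them and has a pole.\<close>
  moreover have "D j (Fract [:c:] 1) = 0" for c
    by (simp add: D_def fract_deriv_Fract[OF derivation_separate_euler]
        derivation.one[OF derivation_separate_euler] Fract_eq_0_iff)
      (simp add: separate_euler_def pderiv_pCons)
  ultimately have "V \<notin> range (\<lambda>c. Fract [:c:] 1)" by auto
  then consider (finite) q g where "prime_elem q" "g \<in> prime_place q" "inverse V = Fract q 1 * g"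
    | (infinite) g where "g \<in> infinite_place" "inverse V = Fract 1 [:0, 1:] * g"
    using pole_cases by blast
  moreover have "V \<noteq> 0"
    using \<open>D j V \<noteq> 0\<close> derivation.zero[OF D] by metis
  moreover have "p \<noteq> 0" using assms by auto
  ultimately show False
  proof cases
    case (finite q g)
    interpret place: dvr "prime_place q" "Fract q 1" by (rule dvr_prime_place[OF finite(1)])
    have D_mem: "D i x \<in> prime_place q" if "x \<in> prime_place q" for i x
      unfolding D_def by (rule fract_deriv_prime_place[OF finite(1) derivation_separate_euler that])
    \<comment> \<open>Multiplying by \<open>q\<close> turns its logarithmic derivatives into the
      \<open>D i (Fract q 1)\<close>, which are regular, so \<open>c = Fract q 1\<close> is
      admissible.\<close>
    have "Fract q 1 * det (\<chi> i l. D l (Y i) / Y i) \<in> prime_place q"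
      using place.uniformizer D_mem[OF place.uniformizer(1)]
      by (intro place.log_jacobian_mem D D_mem Y0) auto
    moreover have "poly (const_poly p0) (separate_fract j ?t1) \<in> prime_place q"
      by (intro place.poly) (auto simp: coeff_const_poly separate_fract_var intro: Fract_1_mem_prime_place[OF finite(1)])
    ultimately have "Fract q 1 ^ 1 * poly (const_poly p) V \<in> prime_place q"
      unfolding F_eq[symmetric] F power_one_right mult.assoc[symmetric] by (rule place.mult)
    then have "degree p \<le> 1"
      using finite \<open>V \<noteq> 0\<close> \<open>p \<noteq> 0\<close>
      by (intro degree_const_poly_le_at_pole[OF place.dvr_axioms _ _ finite(3)]) (auto intro: Fract_1_mem_prime_place)
    then show False using assms by simp
  next
    case (infinite g)
    let ?\<pi> = "Fract 1 [:0, 1:] :: ('n, 'k) ratfun poly fract"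
    interpret place: dvr infinite_place ?\<pi> by (rule dvr_infinite_place)
    have D_mem: "D i x \<in> infinite_place" if "x \<in> infinite_place" for i x
      unfolding D_def
      by (rule fract_deriv_infinite_place[OF derivation_separate_euler degree_separate_euler_le that])
    have "D i ?\<pi> / ?\<pi> \<in> infinite_place" for i
    proof -
      have X: "degree (separate_euler j i [:0, 1 :: ('n, 'k) ratfun:]) \<le> degree [:0, 1 :: ('n, 'k) ratfun:]"
        by (rule degree_separate_euler_le)
      \<comment> \<open>The logarithmic derivative of \<open>1/s\<close> is minus that of
        \<open>s\<close>. By \<open>X\<close> its numerator has degree at most 1, so it is regular
        and \<open>c = 1\<close> is admissible.\<close>
      have "D i ?\<pi> / ?\<pi> = Fract (- separate_euler j i [:0, 1:]) [:0, 1:]"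
        by (simp add: D_def fract_deriv_Fract[OF derivation_separate_euler]
            derivation.one[OF derivation_separate_euler] eq_fract)
      then show ?thesis using X by (auto intro: infinite_placeI)
    qed
    then have "1 * det (\<chi> i l. D l (Y i) / Y i) \<in> infinite_place"
      by (intro place.log_jacobian_mem D D_mem Y0) auto
    \<comment> \<open>The image of \<open>?t1\<close> is \<open>s\<close> or a constant, according
      to whether \<open>j\<close> is the first index; in both cases its pole has order at most
      1.\<close>
    moreover have "?\<pi> * separate_fract j ?t1 \<in> infinite_place"
      by (auto simp: separate_fract_var intro!: infinite_placeI)
    then have "?\<pi> ^ h0 * poly (const_poly p0) (separate_fract j ?t1) \<in> infinite_place"
      using place.power_mult_poly_mem[of "const_poly p0" "separate_fract j ?t1"] assms(6)
      by (simp add: coeff_const_poly degree_const_poly const_mem_infinite_place)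
    ultimately have "det (\<chi> i l. D l (Y i) / Y i) *
        (?\<pi> ^ h0 * poly (const_poly p0) (separate_fract j ?t1)) \<in> infinite_place"
      by (auto intro: place.mult)
    then have "?\<pi> ^ h0 * poly (const_poly p) V \<in> infinite_place"
      unfolding F_eq[symmetric] F by (simp only: mult.left_commute)
    then have "degree p \<le> h0"
      using infinite \<open>V \<noteq> 0\<close> \<open>p \<noteq> 0\<close>
      by (intro degree_const_poly_le_at_pole[OF place.dvr_axioms _ _ infinite(2)]) (auto intro: infinite_placeI)
    then show False using assms by simp
  qed
qed

end
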